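(* Let $(A,b)$ be a linear system over $\mathbb{Z}_d$ with associated simplicial complex $\Sigma$, let $G$ be a group and let $J_G\in G$ be a central element of order $d$. There is a bijective correspondence between the set $\mathrm{Sol}(A,b;G)$ of solutions of $(A,b)$ in $G$ and the set of simplicial set maps $f:N(\mathbb{Z}_d,\Sigma)\to N(\mathbb{Z}_d,G)$ satisfying $f\circ\alpha=\iota\circ\beta$, where $\alpha:\bigvee_{i=1}^r N\mathbb{Z}_d\to N(\mathbb{Z}_d,\Sigma)$, $\beta:\bigvee_{i=1}^r N\mathbb{Z}_d\to N\mathbb{Z}_d$ and $\iota:N\mathbb{Z}_d\to N(\mathbb{Z}_d,G)$ are the maps defined in the context.
   Context: Let $d>1$ be an integer. A linear system $(A,b)$ over $\mathbb{Z}_d$ consists of an $r\times c$ matrix $A$ with entries in $\mathbb{Z}_d$ and a vector $b\in\mathbb{Z}_d^r$. Its simplicial complex $\Sigma$ has vertex set $\Sigma_0=\{v_1,\dots,v_c\}$ and is generated by the simplices $\sigma_i=\{v_j: A_{ij}\neq 0\}$, $1\le i\le r$ (so simplices are the singletons and the subsets of the $\sigma_i$; the empty set is allowed as a support below). The $i$-th row is regarded as the function $A_i:\Sigma_0\to\mathbb{Z}_d$, $A_i(v_j)=A_{ij}$, an element of the group $\mathbb{Z}_d^{\Sigma_0}$ of functions $\Sigma_0\to\mathbb{Z}_d$. Standing assumptions: each row generates a subgroup $\langle A_i\rangle\cong\mathbb{Z}_d$ of $\mathbb{Z}_d^{\Sigma_0}$, and $\langle A_i\rangle\ne\langle A_j\rangle$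 for distinct rows. A solution of $(A,b)$ in $G$ (with respect to $J_G$) is a function $T:\Sigma_0\to G$ such that (i) $T(v)^d=1$ for all $v\in\Sigma_0$; (ii) for every $i$ the elements $\{T(v):v\in\sigma_i\}$ pairwise commute; (iii) $\prod_{v_j\in\sigma_i}T(v_j)^{A_{ij}}=J_G^{b_i}$ for all $1\le i\le r$. The set of solutions is $\mathrm{Sol}(A,b;G)$. For a group $H$, the nerve $NH$ is the simplicial set with $(NH)_n=H^n$, with $d_0(h_1,\dots,h_n)=(h_2,\dots,h_n)$, $d_i$ multiplying $h_i$ and $h_{i+1}$ for $0<i<n$, $d_n$ dropping $h_n$, and $s_j$ inserting the identity after $h_j$. $N(\mathbb{Z}_d,\Sigma)\subset N(\mathbb{Z}_d^{\Sigma_0})$ is the simplicial subset whose $n$-simplices are the tuples $(s_1,\dots,s_n)$ of functions $s_i:\Sigma_0\to\mathbb{Z}_d$ with $\bigcup_i\mathrm{supp}(s_i)\in\Sigma$. $N(\mathbb{Z}_d,G)\subset NG$ is the simplicial subset whose $n$-simplices are the tuples $(g_1,\dots,g_n)$ with $g_i^d=1$ and $g_ig_j=g_jg_i$ for all $i,j$. The map $\iota$ is induced by the homomorphism $\mathbb{Z}_d\to G$, $1\mapsto J_G$. On the $i$-th wedge factor, $\alpha$ is induced by the homomorphism $\mathbb{Z}_d\to\mathbb{Z}_d^{\Sigma_0}$, $1\mapsto A_i$, and $\beta$ is induced by the homomorphism $\mathbb{Z}_d\to\mathbb{Z}_d$, $1\mapsto b_i$. *)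

theory Defs
  imports "HOL-Algebra.Product_Groups" "HOL-Algebra.Multiplicative_Group"
begin

section \<open>Simplicial sets\<close>

text \<open>The operators carry the dimension of their argument: \<open>face X n i\<close> is
  \<open>d\<^sub>i : X\<^sub>n \<rightarrow> X\<^sub>n\<^sub>-\<^sub>1\<close> and \<open>degen X n j\<close> is \<open>s\<^sub>j : X\<^sub>n \<rightarrow> X\<^sub>n\<^sub>+\<^sub>1\<close>. Their values outside of
  \<open>simplices X n\<close> are irrelevant.\<close>

record 'a sset =
  simplices :: "nat \<Rightarrow> 'a set"
  face :: "nat \<Rightarrow> nat \<Rightarrow> 'a \<Rightarrow> 'a"
  degen :: "nat \<Rightarrow> nat \<Rightarrow> 'a \<Rightarrow> 'a"

locale simplicial_set =
  fixes X :: "'a sset"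
  assumes face_closed:
      "\<lbrakk>x \<in> simplices X (Suc n); i \<le> Suc n\<rbrakk> \<Longrightarrow> face X (Suc n) i x \<in> simplices X n"
    and degen_closed:
      "\<lbrakk>x \<in> simplices X n; j \<le> n\<rbrakk> \<Longrightarrow> degen X n j x \<in> simplices X (Suc n)"
    and face_face:
      "\<lbrakk>x \<in> simplices X (Suc (Suc n)); i < j; j \<le> Suc (Suc n)\<rbrakk> \<Longrightarrow>
        face X (Suc n) i (face X (Suc (Suc n)) j x)
        = face X (Suc n) (j - 1) (face X (Suc (Suc n)) i x)"
    and face_degen_less:
      "\<lbrakk>x \<in> simplices X (Suc n); i < j; j \<le> Suc n\<rbrakk> \<Longrightarrow>
        face X (Suc (Suc n)) i (degen X (Suc n) j x) = degen X n (j - 1) (face X (Suc n) i x)"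
    and face_degen_id:
      "\<lbrakk>x \<in> simplices X n; j \<le> n; i = j \<or> i = Suc j\<rbrakk> \<Longrightarrow>
        face X (Suc n) i (degen X n j x) = x"
    and face_degen_greater:
      "\<lbrakk>x \<in> simplices X (Suc n); Suc j < i; i \<le> Suc (Suc n)\<rbrakk> \<Longrightarrow>
        face X (Suc (Suc n)) i (degen X (Suc n) j x) = degen X n j (face X (Suc n) (i - 1) x)"
    and degen_degen:
      "\<lbrakk>x \<in> simplices X n; i \<le> j; j \<le> n\<rbrakk> \<Longrightarrow>
        degen X (Suc n) i (degen X n j x) = degen X (Suc n) (Suc j) (degen X n i x)"

text \<open>Simplicial maps are extensional in each degree, so that equality of functions is equality
  of simplicial maps.\<close>

definition simplicial_maps :: "'a sset \<Rightarrow> 'b sset \<Rightarrow> (nat \<Rightarrow> 'a \<Rightarrow> 'b) set" where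
  "simplicial_maps X Y = {f.
     (\<forall>n. f n \<in> simplices X n \<rightarrow>\<^sub>E simplices Y n) \<and>
     (\<forall>n. \<forall>x \<in> simplices X (Suc n). \<forall>i \<le> Suc n.
        f n (face X (Suc n) i x) = face Y (Suc n) i (f (Suc n) x)) \<and>
     (\<forall>n. \<forall>x \<in> simplices X n. \<forall>j \<le> n.
        f (Suc n) (degen X n j x) = degen Y n j (f n x))}"

definition simplicial_comp ::
    "'a sset \<Rightarrow> (nat \<Rightarrow> 'b \<Rightarrow> 'c) \<Rightarrow> (nat \<Rightarrow> 'a \<Rightarrow> 'b) \<Rightarrow> nat \<Rightarrow> 'a \<Rightarrow> 'c" where
  "simplicial_comp X g f = (\<lambda>n. compose (simplices X n) (g n) (f n))"


section \<open>Wedges\<close>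

fun base_simplex :: "'a sset \<Rightarrow> 'a \<Rightarrow> nat \<Rightarrow> 'a" where
  "base_simplex X x0 0 = x0"
| "base_simplex X x0 (Suc n) = degen X n 0 (base_simplex X x0 n)"

text \<open>The wedge of pointed simplicial sets \<open>(X\<^sub>i, x0\<^sub>i)\<close>: \<open>None\<close> is, in every degree, the common
  base simplex, and \<open>Some (i, x)\<close> is the simplex \<open>x\<close> of the \<open>i\<close>-th factor, different from the base
  simplex. In particular the empty wedge is a point.\<close>

definition wedge_in ::
    "('i \<Rightarrow> 'a sset) \<Rightarrow> ('i \<Rightarrow> 'a) \<Rightarrow> 'i \<Rightarrow> nat \<Rightarrow> 'a \<Rightarrow> ('i \<times> 'a) option" where
  "wedge_in X x0 i n x = (if x = base_simplex (X i) (x0 i) n then None else Some (i, x))"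

definition wedge ::
    "'i set \<Rightarrow> ('i \<Rightarrow> 'a sset) \<Rightarrow> ('i \<Rightarrow> 'a) \<Rightarrow> ('i \<times> 'a) option sset" where
  "wedge I X x0 = \<lparr>
     simplices = (\<lambda>n. insert None {wedge_in X x0 i n x |i x. i \<in> I \<and> x \<in> simplices (X i) n}),
     face = (\<lambda>n k w. case w of None \<Rightarrow> None
               | Some (i, x) \<Rightarrow> wedge_in X x0 i (n - 1) (face (X i) n k x)),
     degen = (\<lambda>n k w. case w of None \<Rightarrow> None
               | Some (i, x) \<Rightarrow> wedge_in X x0 i (Suc n) (degen (X i) n k x))\<rparr>"

text \<open>The map out of a wedge given by \<open>\<phi>\<^sub>i\<close> on the \<open>i\<close>-th factor, where \<open>y0\<close> is the base point of
  the target.\<close>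

definition wedge_map ::
    "'i set \<Rightarrow> ('i \<Rightarrow> 'a sset) \<Rightarrow> ('i \<Rightarrow> 'a) \<Rightarrow> 'b sset \<Rightarrow> 'b \<Rightarrow> ('i \<Rightarrow> nat \<Rightarrow> 'a \<Rightarrow> 'b)
      \<Rightarrow> nat \<Rightarrow> ('i \<times> 'a) option \<Rightarrow> 'b" where
  "wedge_map I X x0 Y y0 \<phi> = (\<lambda>n. \<lambda>w \<in> simplices (wedge I X x0) n.
     case w of None \<Rightarrow> base_simplex Y y0 n | Some (i, x) \<Rightarrow> \<phi> i n x)"


section \<open>Nerves\<close>

text \<open>An \<open>n\<close>-simplex \<open>(h\<^sub>1, \<dots>, h\<^sub>n)\<close> is a list of length \<open>n\<close>; \<open>h\<^sub>k\<close> is \<open>h ! (k - 1)\<close>.\<close>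

definition nerve :: "('a, 'm) monoid_scheme \<Rightarrow> 'a list sset" where
  "nerve H = \<lparr>
     simplices = (\<lambda>n. {h. length h = n \<and> set h \<subseteq> carrier H}),
     face = (\<lambda>n i h. if i = 0 then tl h
               else if i = n then butlast h
               else take (i - 1) h @ [h ! (i - 1) \<otimes>\<^bsub>H\<^esub> h ! i] @ drop (Suc i) h),
     degen = (\<lambda>n j h. take j h @ [\<one>\<^bsub>H\<^esub>] @ drop j h)\<rparr>"

text \<open>The map of nerves induced by a homomorphism; \<open>X\<close> is the nerve of the source or a
  simplicial subset of it.\<close>

definition induced_map :: "'a list sset \<Rightarrow> ('a \<Rightarrow> 'b) \<Rightarrow> nat \<Rightarrow> 'a list \<Rightarrow> 'b list" where
  "induced_map X \<phi> = (\<lambda>n. \<lambda>h \<in> simplices X n. map \<phi> h)"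

text \<open>The homomorphism \<open>\<int>\<^sub>d \<rightarrow> H\<close>, \<open>1 \<mapsto> a\<close>, for an element \<open>a\<close> with \<open>a\<^sup>d = 1\<close>; residues are
  represented by \<open>0, \<dots>, d - 1\<close>.\<close>

definition cyclic_hom :: "('a, 'm) monoid_scheme \<Rightarrow> 'a \<Rightarrow> int \<Rightarrow> 'a" where
  "cyclic_hom H a = (\<lambda>k. a [^]\<^bsub>H\<^esub> k)"


section \<open>Linear systems\<close>

text \<open>The vertex \<open>v\<^sub>j\<close> is represented by its index, with indices starting at \<open>0\<close>; thus
  \<open>\<Sigma>\<^sub>0 = {..<c}\<close>. A matrix is given by its rows, which are elements of \<open>\<int>\<^sub>d\<^bsup>\<Sigma>\<^sub>0\<^esup>\<close>.\<close>

abbreviation Zmod :: "nat \<Rightarrow> int monoid" where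
  "Zmod d \<equiv> integer_mod_group d"

abbreviation Zd_functions :: "nat \<Rightarrow> nat \<Rightarrow> (nat \<Rightarrow> int) monoid" where
  "Zd_functions d c \<equiv> product_group {..<c} (\<lambda>_. Zmod d)"

definition linear_system ::
    "nat \<Rightarrow> nat \<Rightarrow> nat \<Rightarrow> (nat \<Rightarrow> nat \<Rightarrow> int) \<Rightarrow> (nat \<Rightarrow> int) \<Rightarrow> bool" where
  "linear_system d r c A b \<longleftrightarrow>
     (\<forall>i<r. A i \<in> carrier (Zd_functions d c)) \<and> (\<forall>i<r. b i \<in> carrier (Zmod d))"

definition supp :: "nat \<Rightarrow> (nat \<Rightarrow> int) \<Rightarrow> nat set" where
  "supp c s = {j. j < c \<and> s j \<noteq> 0}"

definition system_complex :: "nat \<Rightarrow> nat \<Rightarrow> (nat \<Rightarrow> nat \<Rightarrow> int) \<Rightarrow> nat set set" where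
  "system_complex r c A = {{}} \<union> {{j} |j. j < c} \<union> (\<Union>i<r. Pow (supp c (A i)))"

text \<open>The factors of the product in condition (iii) commute by (ii), so it may be taken in the
  order of the indices.\<close>

definition ordered_prod :: "('a, 'm) monoid_scheme \<Rightarrow> ('i \<Rightarrow> 'a) \<Rightarrow> 'i list \<Rightarrow> 'a" where
  "ordered_prod G f js = foldr (\<lambda>j x. f j \<otimes>\<^bsub>G\<^esub> x) js \<one>\<^bsub>G\<^esub>"

definition Sol ::
    "nat \<Rightarrow> nat \<Rightarrow> nat \<Rightarrow> (nat \<Rightarrow> nat \<Rightarrow> int) \<Rightarrow> (nat \<Rightarrow> int)
      \<Rightarrow> ('g, 'm) monoid_scheme \<Rightarrow> 'g \<Rightarrow> (nat \<Rightarrow> 'g) set" where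
  "Sol d r c A b G J = {T \<in> {..<c} \<rightarrow>\<^sub>E carrier G.
     (\<forall>j<c. T j [^]\<^bsub>G\<^esub> d = \<one>\<^bsub>G\<^esub>) \<and>
     (\<forall>i<r. \<forall>j \<in> supp c (A i). \<forall>k \<in> supp c (A i). T j \<otimes>\<^bsub>G\<^esub> T k = T k \<otimes>\<^bsub>G\<^esub> T j) \<and>
     (\<forall>i<r. ordered_prod G (\<lambda>j. T j [^]\<^bsub>G\<^esub> A i j) (sorted_list_of_set (supp c (A i)))
            = J [^]\<^bsub>G\<^esub> b i)}"


section \<open>The simplicial sets and maps attached to a linear system\<close>

definition N_complex :: "nat \<Rightarrow> nat \<Rightarrow> nat set set \<Rightarrow> (nat \<Rightarrow> int) list sset" where
  "N_complex d c \<Sigma> = nerve (Zd_functions d c)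
     \<lparr>simplices := (\<lambda>n. {h \<in> simplices (nerve (Zd_functions d c)) n. (\<Union>s \<in> set h. supp c s) \<in> \<Sigma>})\<rparr>"

definition N_torsion :: "nat \<Rightarrow> ('g, 'm) monoid_scheme \<Rightarrow> 'g list sset" where
  "N_torsion d G = nerve G
     \<lparr>simplices := (\<lambda>n. {h \<in> simplices (nerve G) n.
        (\<forall>g \<in> set h. g [^]\<^bsub>G\<^esub> d = \<one>\<^bsub>G\<^esub>) \<and>
        (\<forall>g \<in> set h. \<forall>g' \<in> set h. g \<otimes>\<^bsub>G\<^esub> g' = g' \<otimes>\<^bsub>G\<^esub> g)})\<rparr>"

text \<open>The only vertex of a nerve is the empty tuple, so this is the base point everywhere.\<close>

definition NZ_wedge :: "nat \<Rightarrow> nat \<Rightarrow> (nat \<times> int list) option sset" where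
  "NZ_wedge d r = wedge {..<r} (\<lambda>_. nerve (Zmod d)) (\<lambda>_. [])"

definition alpha_map ::
    "nat \<Rightarrow> nat \<Rightarrow> nat \<Rightarrow> (nat \<Rightarrow> nat \<Rightarrow> int)
      \<Rightarrow> nat \<Rightarrow> (nat \<times> int list) option \<Rightarrow> (nat \<Rightarrow> int) list" where
  "alpha_map d r c A = wedge_map {..<r} (\<lambda>_. nerve (Zmod d)) (\<lambda>_. [])
     (N_complex d c (system_complex r c A)) []
     (\<lambda>i. induced_map (nerve (Zmod d)) (cyclic_hom (Zd_functions d c) (A i)))"

definition beta_map ::
    "nat \<Rightarrow> nat \<Rightarrow> (nat \<Rightarrow> int) \<Rightarrow> nat \<Rightarrow> (nat \<times> int list) option \<Rightarrow> int list" where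
  "beta_map d r b = wedge_map {..<r} (\<lambda>_. nerve (Zmod d)) (\<lambda>_. []) (nerve (Zmod d)) []
     (\<lambda>i. induced_map (nerve (Zmod d)) (cyclic_hom (Zmod d) (b i)))"

definition iota_map :: "nat \<Rightarrow> ('g, 'm) monoid_scheme \<Rightarrow> 'g \<Rightarrow> nat \<Rightarrow> int list \<Rightarrow> 'g list" where
  "iota_map d G J = induced_map (nerve (Zmod d)) (cyclic_hom G J)"


section \<open>Well-definedness\<close>

text \<open>Wedges, nerves, \<open>N(\<int>\<^sub>d, \<Sigma>)\<close> and \<open>N(\<int>\<^sub>d, G)\<close> are simplicial sets, and \<open>\<alpha>\<close>, \<open>\<beta>\<close> and \<open>\<iota>\<close> are
  simplicial maps between them.\<close>

lemma (in simplicial_set) base_closed: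
  "x0 \<in> simplices X 0 \<Longrightarrow> base_simplex X x0 n \<in> simplices X n"
  by (induction n) (auto intro: degen_closed)

lemma (in simplicial_set) degen_base:
  "x0 \<in> simplices X 0 \<Longrightarrow> j \<le> n \<Longrightarrow> degen X n j (base_simplex X x0 n) = base_simplex X x0 (Suc n)"
proof (induction n arbitrary: j)
  case (Suc n)
  show ?case
  proof (cases j)
    case (Suc k)
    have "degen X (Suc n) 0 (degen X n k (base_simplex X x0 n)) = degen X (Suc n) (Suc k) (degen X n 0 (base_simplex X x0 n))"
      using Suc Suc.prems by (intro degen_degen base_closed) auto
    with Suc Suc.IH[of k] Suc.prems show ?thesis by simp
  qed simp
qed simp

lemma (in simplicial_set) face_base:
  "x0 \<in> simplices X 0 \<Longrightarrow> i \<le> Suc n \<Longrightarrow> face X (Suc n) i (base_simplex X x0 (Suc n)) = base_simplex X x0 n"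
proof (induction n arbitrary: i)
  case 0
  then show ?case by (auto intro!: face_degen_id)
next
  case (Suc n)
  show ?case
  proof (cases "i \<le> 1")
    case True
    with Suc.prems show ?thesis
      using face_degen_id[of "base_simplex X x0 (Suc n)" "Suc n" 0 i] base_closed[of x0 "Suc n"] by force
  next
    case False
    then have "face X (Suc (Suc n)) i (degen X (Suc n) 0 (base_simplex X x0 (Suc n)))
       = degen X n 0 (face X (Suc n) (i - 1) (base_simplex X x0 (Suc n)))"
      using Suc.prems by (intro face_degen_greater base_closed) auto
    with Suc.IH[of "i-1"] Suc.prems False show ?thesis by simp
  qed
qed

lemma wedge_simps:
  "simplices (wedge I X x0) n = insert None {wedge_in X x0 i n x |i x. i \<in> I \<and> x \<in> simplices (X i) n}"
  "face (wedge I X x0) n k None = None" "degen (wedge I X x0) n k None = None"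
  by (auto simp: wedge_def)

lemma face_wedge_in:
  assumes "simplicial_set (X i)" "x0 i \<in> simplices (X i) 0" "k \<le> Suc n"
  shows "face (wedge I X x0) (Suc n) k (wedge_in X x0 i (Suc n) x) = wedge_in X x0 i n (face (X i) (Suc n) k x)"
  using simplicial_set.face_base[OF assms] by (auto simp: wedge_def wedge_in_def simp del: base_simplex.simps)

lemma degen_wedge_in:
  assumes "simplicial_set (X i)" "x0 i \<in> simplices (X i) 0" "k \<le> n"
  shows "degen (wedge I X x0) n k (wedge_in X x0 i n x) = wedge_in X x0 i (Suc n) (degen (X i) n k x)"
  using simplicial_set.degen_base[OF assms] by (auto simp: wedge_def wedge_in_def simp del: base_simplex.simps)

lemma simplicial_set_wedge:
  assumes S: "\<And>i. i \<in> I \<Longrightarrow> simplicial_set (X i)" and x0: "\<And>i. i \<in> I \<Longrightarrow> x0 i \<in> simplices (X i) 0"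
  shows "simplicial_set (wedge I X x0)"
proof -
  have fw: "face (wedge I X x0) (Suc n) k (wedge_in X x0 i (Suc n) x) = wedge_in X x0 i n (face (X i) (Suc n) k x)"
    if "i \<in> I" "k \<le> Suc n" for i n k x
    using that by (intro face_wedge_in S x0)
  have dw: "degen (wedge I X x0) n k (wedge_in X x0 i n x) = wedge_in X x0 i (Suc n) (degen (X i) n k x)"
    if "i \<in> I" "k \<le> n" for i n k x
    using that by (intro degen_wedge_in S x0)
  note [simp] = fw dw wedge_simps
  show ?thesis
  proof (unfold_locales, goal_cases)
    case 1 then show ?case using simplicial_set.face_closed[OF S] by fastforce
  next case 2 then show ?case using simplicial_set.degen_closed[OF S] by fastforce
  next case (3 x n i j)
    then show ?case using simplicial_set.face_face[OF S, of _ _ n i j] by (auto)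
  next case (4 x n i j) then show ?case using simplicial_set.face_degen_less[OF S, of _ _ n i j] by (auto)
  next case (5 x n j i) then show ?case using simplicial_set.face_degen_id[OF S, of _ _ n j i] by (auto)
  next case (6 x n j i) then show ?case using simplicial_set.face_degen_greater[OF S, of _ _ n j i] by (auto)
  next case (7 x n i j) then show ?case using simplicial_set.degen_degen[OF S, of _ _ n i j] by (auto)
  qed
qed

lemma simplicial_map_wedge_map:
  assumes S: "\<And>i. i \<in> I \<Longrightarrow> simplicial_set (X i)" and x0: "\<And>i. i \<in> I \<Longrightarrow> x0 i \<in> simplices (X i) 0"
    and Y: "simplicial_set Y" and y0: "y0 \<in> simplices Y 0"
    and \<phi>: "\<And>i. i \<in> I \<Longrightarrow> \<phi> i \<in> simplicial_maps (X i) Y" and b: "\<And>i. i \<in> I \<Longrightarrow> \<phi> i 0 (x0 i) = y0"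
  shows "wedge_map I X x0 Y y0 \<phi> \<in> simplicial_maps (wedge I X x0) Y"
    and "\<And>i n x. i \<in> I \<Longrightarrow> x \<in> simplices (X i) n \<Longrightarrow>
      wedge_map I X x0 Y y0 \<phi> n (wedge_in X x0 i n x) = \<phi> i n x"
proof -
  interpret Y: simplicial_set Y by fact
  have bs: "\<phi> i n (base_simplex (X i) (x0 i) n) = base_simplex Y y0 n" if "i \<in> I" for i n
  proof (induction n)
    case (Suc n)
    then show ?case using \<phi>[OF that] simplicial_set.base_closed[OF S x0, OF that that]
      by (auto simp: simplicial_maps_def)
  qed (simp add: b that)
  show *: "wedge_map I X x0 Y y0 \<phi> n (wedge_in X x0 i n x) = \<phi> i n x"
    if "i \<in> I" "x \<in> simplices (X i) n" for i n x
    using that bs by (auto simp: wedge_map_def wedge_in_def wedge_simps)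
  have N: "wedge_map I X x0 Y y0 \<phi> n None = base_simplex Y y0 n" for n
    by (simp add: wedge_map_def wedge_simps)
  have cl: "\<phi> i n x \<in> simplices Y n" if "i \<in> I" "x \<in> simplices (X i) n" for i n x
    using \<phi>[OF that(1)] that(2) by (auto simp: simplicial_maps_def)
  have fw: "face (wedge I X x0) (Suc n) k (wedge_in X x0 i (Suc n) x) = wedge_in X x0 i n (face (X i) (Suc n) k x)"
    if "i \<in> I" "k \<le> Suc n" for i n k x
    using that by (intro face_wedge_in S x0)
  have dw: "degen (wedge I X x0) n k (wedge_in X x0 i n x) = wedge_in X x0 i (Suc n) (degen (X i) n k x)"
    if "i \<in> I" "k \<le> n" for i n k x
    using that by (intro degen_wedge_in S x0)
  have fc: "face (X i) (Suc n) k x \<in> simplices (X i) n" if "i \<in> I" "x \<in> simplices (X i) (Suc n)" "k \<le> Suc n" for i n k x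
    using simplicial_set.face_closed[OF S] that by blast
  have dc: "degen (X i) n k x \<in> simplices (X i) (Suc n)" if "i \<in> I" "x \<in> simplices (X i) n" "k \<le> n" for i n k x
    using simplicial_set.degen_closed[OF S] that by blast
  have f: "\<phi> i n (face (X i) (Suc n) k x) = face Y (Suc n) k (\<phi> i (Suc n) x)" if "i \<in> I" "x \<in> simplices (X i) (Suc n)" "k \<le> Suc n" for i n k x
    using \<phi>[OF that(1)] that by (auto simp: simplicial_maps_def)
  have d: "\<phi> i (Suc n) (degen (X i) n k x) = degen Y n k (\<phi> i n x)" if "i \<in> I" "x \<in> simplices (X i) n" "k \<le> n" for i n k x
    using \<phi>[OF that(1)] that by (auto simp: simplicial_maps_def)
  show "wedge_map I X x0 Y y0 \<phi> \<in> simplicial_maps (wedge I X x0) Y"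
    unfolding simplicial_maps_def
  proof (clarsimp, intro conjI allI ballI impI, goal_cases)
    case (1 n)
    have "wedge_map I X x0 Y y0 \<phi> n w \<in> simplices Y n" if "w \<in> simplices (wedge I X x0) n" for w
      using that by (auto simp: wedge_simps N * cl Y.base_closed y0)
    then show ?case by (auto simp: wedge_map_def[abs_def] simp del: restrict_apply intro!: restrict_PiE)
       (auto simp: wedge_map_def)
  next
    case (2 n w k)
    then show ?case using Y.face_base[OF y0]
      by (auto simp: wedge_simps N * fw fc f simp del: base_simplex.simps)
  next
    case (3 n w k)
    then show ?case using Y.degen_base[OF y0]
      by (auto simp: wedge_simps N * dw dc d simp del: base_simplex.simps)
  qed
qed

lemma nerve_simps:
  "h \<in> simplices (nerve H) n \<longleftrightarrow> length h = n \<and> set h \<subseteq> carrier H"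
  by (simp add: nerve_def)

lemma length_face_nerve: "length h = Suc n \<Longrightarrow> i \<le> Suc n \<Longrightarrow> length (face (nerve H) (Suc n) i h) = n"
  by (auto simp: nerve_def)

lemma length_degen_nerve: "length h = n \<Longrightarrow> j \<le> n \<Longrightarrow> length (degen (nerve H) n j h) = Suc n"
  by (auto simp: nerve_def)

lemma nth_face_nerve:
  assumes "length h = Suc n" "i \<le> Suc n" "k < n"
  shows "face (nerve H) (Suc n) i h ! k =
    (if Suc k < i then h ! k else if Suc k = i then h ! k \<otimes>\<^bsub>H\<^esub> h ! Suc k else h ! Suc k)"
  using assms by (auto simp: nerve_def nth_tl nth_butlast nth_append min_def nth_Cons' intro!: arg_cong[where f = "(!) h"])

lemma nth_degen_nerve:
  assumes "length h = n" "j \<le> n" "k \<le> n"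
  shows "degen (nerve H) n j h ! k = (if k < j then h ! k else if k = j then \<one>\<^bsub>H\<^esub> else h ! (k - 1))"
  using assms by (auto simp: nerve_def nth_append min_def nth_Cons' intro!: arg_cong[where f = "(!) h"])

lemma simplicial_set_nerve:
  assumes "monoid H"
  shows "simplicial_set (nerve H)"
proof -
  interpret monoid H by fact
  have nth_in: "h ! k \<in> carrier H" if "set h \<subseteq> carrier H" "k < length h" for h k
    using that nth_mem by blast
  note s = nerve_simps length_face_nerve length_degen_nerve nth_face_nerve nth_degen_nerve
  show ?thesis
  proof (unfold_locales, goal_cases)
    case (1 x n i)
    have "face (nerve H) (Suc n) i x ! k \<in> carrier H" if "k < n" for k
      using 1 that by (auto simp: s nth_in)
    with 1 show ?case by (auto simp: s in_set_conv_nth)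
  next
    case (2 x n j)
    have "degen (nerve H) n j x ! k \<in> carrier H" if "k \<le> n" for k
      using 2 that by (auto simp: s nth_in)
    with 2 show ?case by (auto simp: s in_set_conv_nth)
  next case (3 x n i j)
    then show ?case by (intro nth_equalityI) (auto simp: s nth_in m_assoc)
  next case (4 x n i j) then show ?case by (intro nth_equalityI) (auto simp: s nth_in not_less_eq)
  next case (5 x n j i) then show ?case by (intro nth_equalityI) (auto simp: s nth_in)
  next case (6 x n j i) then show ?case by (intro nth_equalityI) (auto simp: s nth_in)
  next case (7 x n i j) then show ?case by (intro nth_equalityI) (auto simp: s nth_in)
  qed
qed


lemma simplicial_set_subset:
  assumes "simplicial_set X" "\<And>n. S n \<subseteq> simplices X n"
    and "\<And>n x i. \<lbrakk>x \<in> S (Suc n); i \<le> Suc n\<rbrakk> \<Longrightarrow> face X (Suc n) i x \<in> S n"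
    and "\<And>n x j. \<lbrakk>x \<in> S n; j \<le> n\<rbrakk> \<Longrightarrow> degen X n j x \<in> S (Suc n)"
  shows "simplicial_set (X\<lparr>simplices := S\<rparr>)"
proof -
  interpret simplicial_set X by fact
  show ?thesis
    using assms(2) by unfold_locales
      (auto simp: assms(3,4) subset_iff simp del: One_nat_def intro: face_face face_degen_less face_degen_id
         face_degen_greater degen_degen)
qed

lemma set_face_nerve:
  assumes "length h = Suc n" "i \<le> Suc n"
  shows "set (face (nerve H) (Suc n) i h) \<subseteq> set h \<union> {x \<otimes>\<^bsub>H\<^esub> y |x y. x \<in> set h \<and> y \<in> set h}"
proof
  fix z assume "z \<in> set (face (nerve H) (Suc n) i h)"
  then obtain k where "k < n" "z = face (nerve H) (Suc n) i h ! k"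
    using length_face_nerve[OF assms] by (metis in_set_conv_nth)
  with assms show "z \<in> set h \<union> {x \<otimes>\<^bsub>H\<^esub> y |x y. x \<in> set h \<and> y \<in> set h}"
    by (auto simp: nth_face_nerve split: if_splits) (metis Suc_mono less_SucI nth_mem)
qed

lemma set_degen_nerve: "set (degen (nerve H) n j h) = insert \<one>\<^bsub>H\<^esub> (set h)"
  unfolding nerve_def by simp (metis append_take_drop_id set_append)

lemma simplicial_set_N_torsion:
  fixes G (structure)
  assumes "group G"
  shows "simplicial_set (N_torsion d G)"
  unfolding N_torsion_def
proof (rule simplicial_set_subset)
  interpret group G by fact
  show N: "simplicial_set (nerve G)" by (rule simplicial_set_nerve) (rule is_monoid)
  fix n x i assume i: "i \<le> Suc n"
    and x: "x \<in> {h \<in> simplices (nerve G) (Suc n). (\<forall>g\<in>set h. g [^]\<^bsub>G\<^esub> d = \<one>\<^bsub>G\<^esub>) \<and> (\<forall>g\<in>set h. \<forall>g'\<in>set h. g \<otimes>\<^bsub>G\<^esub> g' = g' \<otimes>\<^bsub>G\<^esub> g)}"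
  let ?S = "set x \<union> {g \<otimes> g' |g g'. g \<in> set x \<and> g' \<in> set x}"
  have sub: "set (face (nerve G) (Suc n) i x) \<subseteq> ?S"
    using x i by (intro set_face_nerve) (auto simp: nerve_simps)
  have c: "g \<otimes> g' = g' \<otimes> g" if "g \<in> set x" "g' \<in> set x" for g g' using x that by auto
  have m: "g \<in> carrier G" if "g \<in> set x" for g using x that by (auto simp: nerve_simps)
  have 1: "g [^] d = \<one>" if "g \<in> ?S" for g
    using that x by (auto simp: pow_mult_distrib c m)
  have 2: "g \<otimes> (u \<otimes> v) = (u \<otimes> v) \<otimes> g" if "g \<in> set x" "u \<in> set x" "v \<in> set x" for g u v
    using that by (metis c m m_assoc)
  have 3: "(g \<otimes> h) \<otimes> (u \<otimes> v) = (u \<otimes> v) \<otimes> (g \<otimes> h)" if "g \<in> set x" "h \<in> set x" "u \<in> set x" "v \<in> set x" for g h u v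
    using that 2 by (smt (verit) m m_assoc m_closed)
  have 4: "g \<otimes> g' = g' \<otimes> g" if "g \<in> ?S" "g' \<in> ?S" for g g'
    using that c by (auto simp: 2 3)
  show "face (nerve G) (Suc n) i x \<in> {h \<in> simplices (nerve G) n. (\<forall>g\<in>set h. g [^]\<^bsub>G\<^esub> d = \<one>\<^bsub>G\<^esub>) \<and> (\<forall>g\<in>set h. \<forall>g'\<in>set h. g \<otimes>\<^bsub>G\<^esub> g' = g' \<otimes>\<^bsub>G\<^esub> g)}"
    using simplicial_set.face_closed[OF N _ i, of x] x sub 1 4 by (simp add: subset_iff)
next
  interpret group G by fact
  have N: "simplicial_set (nerve G)" by (rule simplicial_set_nerve) (rule is_monoid)
  fix n x j assume j: "j \<le> n"
    and x: "x \<in> {h \<in> simplices (nerve G) n. (\<forall>g\<in>set h. g [^]\<^bsub>G\<^esub> d = \<one>\<^bsub>G\<^esub>) \<and> (\<forall>g\<in>set h. \<forall>g'\<in>set h. g \<otimes>\<^bsub>G\<^esub> g' = g' \<otimes>\<^bsub>G\<^esub> g)}"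
  then show "degen (nerve G) n j x \<in> {h \<in> simplices (nerve G) (Suc n). (\<forall>g\<in>set h. g [^]\<^bsub>G\<^esub> d = \<one>\<^bsub>G\<^esub>) \<and> (\<forall>g\<in>set h. \<forall>g'\<in>set h. g \<otimes>\<^bsub>G\<^esub> g' = g' \<otimes>\<^bsub>G\<^esub> g)}"
    using simplicial_set.degen_closed[OF N _ j, of x] by (auto simp: set_degen_nerve nerve_simps subset_iff)
qed auto

lemma group_Zd_functions: "group (Zd_functions d c)"
  by simp

lemma supp_mult: "supp c (s \<otimes>\<^bsub>Zd_functions d c\<^esub> t) \<subseteq> supp c s \<union> supp c t"
  by (auto simp: supp_def)

lemma supp_one: "supp c \<one>\<^bsub>Zd_functions d c\<^esub> = {}"
  by (auto simp: supp_def)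

lemma simplicial_set_N_complex:
  assumes "\<And>S T. S \<in> \<Sigma> \<Longrightarrow> T \<subseteq> S \<Longrightarrow> T \<in> \<Sigma>"
  shows "simplicial_set (N_complex d c \<Sigma>)"
  unfolding N_complex_def
proof (rule simplicial_set_subset)
  show N: "simplicial_set (nerve (Zd_functions d c))"
    by (intro simplicial_set_nerve group.is_monoid group_Zd_functions)
  fix n x i assume i: "i \<le> Suc n"
    and x: "x \<in> {h \<in> simplices (nerve (Zd_functions d c)) (Suc n). (\<Union>s\<in>set h. supp c s) \<in> \<Sigma>}"
  have "set (face (nerve (Zd_functions d c)) (Suc n) i x)
     \<subseteq> set x \<union> {g \<otimes>\<^bsub>Zd_functions d c\<^esub> g' |g g'. g \<in> set x \<and> g' \<in> set x}"
    using x i by (intro set_face_nerve) (auto simp: nerve_simps)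
  then have "(\<Union>s\<in>set (face (nerve (Zd_functions d c)) (Suc n) i x). supp c s) \<subseteq> (\<Union>s\<in>set x. supp c s)"
    using supp_mult[where c = c and d = d] by (blast dest!: subsetD)
  then show "face (nerve (Zd_functions d c)) (Suc n) i x
      \<in> {h \<in> simplices (nerve (Zd_functions d c)) n. (\<Union>s\<in>set h. supp c s) \<in> \<Sigma>}"
    using simplicial_set.face_closed[OF N _ i, of x] x assms by blast
next
  have N: "simplicial_set (nerve (Zd_functions d c))"
    by (intro simplicial_set_nerve group.is_monoid group_Zd_functions)
  fix n x j assume j: "j \<le> n"
    and x: "x \<in> {h \<in> simplices (nerve (Zd_functions d c)) n. (\<Union>s\<in>set h. supp c s) \<in> \<Sigma>}"
  then show "degen (nerve (Zd_functions d c)) n j x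
      \<in> {h \<in> simplices (nerve (Zd_functions d c)) (Suc n). (\<Union>s\<in>set h. supp c s) \<in> \<Sigma>}"
    using simplicial_set.degen_closed[OF N _ j, of x]
    by (simp add: set_degen_nerve supp_one del: one_product_group)
qed auto

lemma system_complex_subset: "S \<in> system_complex r c A \<Longrightarrow> T \<subseteq> S \<Longrightarrow> T \<in> system_complex r c A"
  unfolding system_complex_def by (auto simp: subset_singleton_iff) (meson lessThan_iff order_trans)

lemma (in group) cyclic_hom_hom:
  assumes "a \<in> carrier G" "a [^] d = \<one>"
  shows "cyclic_hom G a \<in> hom (Zmod d) G"
proof -
  have m: "a [^] (k mod int d) = a [^] k" for k
  proof -
    have "a [^] k = a [^] (int d * (k div int d)) \<otimes> a [^] (k mod int d)"
      using assms by (simp flip: int_pow_mult)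
    also have "a [^] (int d * (k div int d)) = \<one>"
      using assms by (simp flip: int_pow_pow add: int_pow_int)
    finally show ?thesis using assms by simp
  qed
  show ?thesis using assms by (auto simp: hom_def cyclic_hom_def m int_pow_mult)
qed

lemma induced_map_simplicial:
  assumes "group H" "group K" "\<phi> \<in> hom H K"
    and "\<And>n h. h \<in> simplices (nerve H) n \<Longrightarrow> map \<phi> h \<in> S n"
  shows "induced_map (nerve H) \<phi> \<in> simplicial_maps (nerve H) (nerve K\<lparr>simplices := S\<rparr>)"
proof -
  interpret group_hom H K \<phi> using assms by (simp add: group_hom_def group_hom_axioms_def)
  have N: "simplicial_set (nerve H)" by (rule simplicial_set_nerve) (rule G.is_monoid)
  note s = nerve_simps length_face_nerve length_degen_nerve nth_face_nerve nth_degen_nerve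
  have f: "map \<phi> (face (nerve H) (Suc n) i h) = face (nerve K) (Suc n) i (map \<phi> h)"
    if "h \<in> simplices (nerve H) (Suc n)" "i \<le> Suc n" for h i n
    using that by (intro nth_equalityI) (auto simp: s subset_iff)
  have d: "map \<phi> (degen (nerve H) n i h) = degen (nerve K) n i (map \<phi> h)"
    if "h \<in> simplices (nerve H) n" "i \<le> n" for h i n
    using that by (intro nth_equalityI) (auto simp: s)
  show ?thesis
    using simplicial_set.face_closed[OF N] simplicial_set.degen_closed[OF N] f d assms(4)
    by (auto simp: simplicial_maps_def induced_map_def)
qed

lemma simplicial_iota:
  fixes G (structure)
  assumes "group G" "J \<in> carrier G" "group.ord G J = d"
  shows "iota_map d G J \<in> simplicial_maps (nerve (Zmod d)) (N_torsion d G)"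
proof -
  interpret group G by fact
  have J: "J [^] d = \<one>" using assms(2,3) pow_ord_eq_1 by blast
  have "(J [^] (k::int)) [^] d = \<one>" for k
    using assms(2) J by (metis int_pow_int int_pow_one int_pow_pow mult.commute)
  moreover have "J [^] (k::int) \<otimes> J [^] (l::int) = J [^] l \<otimes> J [^] k" for k l
    using assms(2) by (metis add.commute int_pow_mult)
  ultimately show ?thesis unfolding iota_map_def N_torsion_def
    using assms(2) by (intro induced_map_simplicial cyclic_hom_hom J assms(1) group_integer_mod_group)
      (auto simp: nerve_simps cyclic_hom_def)
qed

lemma Zd_functions_pow:
  assumes "s \<in> carrier (Zd_functions d c)"
  shows "s [^]\<^bsub>Zd_functions d c\<^esub> (m::nat) = (\<lambda>j\<in>{..<c}. (int m * s j) mod int d)"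
  by (induction m) (auto simp: restrict_def fun_eq_iff mod_simps algebra_simps)

lemma simplicial_alpha_beta:
  assumes "d > 1" "linear_system d r c A b"
  shows "alpha_map d r c A \<in> simplicial_maps (NZ_wedge d r) (N_complex d c (system_complex r c A))"
    and "beta_map d r b \<in> simplicial_maps (NZ_wedge d r) (nerve (Zmod d))"
proof -
  interpret Z: group "Zmod d" by simp
  interpret F: group "Zd_functions d c" by simp
  have N: "simplicial_set (nerve (Zmod d))" by (intro simplicial_set_nerve Z.is_monoid)
  have A: "A i \<in> carrier (Zd_functions d c)" and b: "b i \<in> carrier (Zmod d)" if "i < r" for i
    using assms that by (auto simp: linear_system_def)
  have Ad: "A i [^]\<^bsub>Zd_functions d c\<^esub> d = \<one>\<^bsub>Zd_functions d c\<^esub>" if "i < r" for i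
    using Zd_functions_pow[OF A[OF that], of d] by simp
  have bd: "b i [^]\<^bsub>Zmod d\<^esub> d = \<one>\<^bsub>Zmod d\<^esub>" for i by simp
  have supn: "supp c (A i [^]\<^bsub>Zd_functions d c\<^esub> (n::nat)) \<subseteq> supp c (A i)" if "i < r" for i n
    unfolding Zd_functions_pow[OF A[OF that]] by (auto simp: supp_def)
  have sup: "supp c (A i [^]\<^bsub>Zd_functions d c\<^esub> (k::int)) \<subseteq> supp c (A i)" if "i < r" "0 \<le> k" for i k
    using supn[OF that(1), of "nat k"] that(2) by (metis int_pow_int nat_0_le)
  show "alpha_map d r c A \<in> simplicial_maps (NZ_wedge d r) (N_complex d c (system_complex r c A))"
    unfolding alpha_map_def NZ_wedge_def
  proof (rule simplicial_map_wedge_map(1))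
    show "simplicial_set (N_complex d c (system_complex r c A))"
      by (rule simplicial_set_N_complex) (rule system_complex_subset)
    fix i assume "i \<in> {..<r}"
    then have i: "i < r" by simp
    have U: "(\<Union>s\<in>set h. supp c (A i [^]\<^bsub>Zd_functions d c\<^esub> s)) \<in> system_complex r c A"
      if "\<And>k. k \<in> set h \<Longrightarrow> 0 \<le> k" for h :: "int list"
    proof (rule system_complex_subset)
      show "supp c (A i) \<in> system_complex r c A" using i by (auto simp: system_complex_def)
      show "(\<Union>s\<in>set h. supp c (A i [^]\<^bsub>Zd_functions d c\<^esub> s)) \<subseteq> supp c (A i)"
        by (rule UN_least) (rule sup[OF i that])
    qed
    have cl: "\<And>k. A i [^]\<^bsub>Zd_functions d c\<^esub> (k::int) \<in> carrier (Zd_functions d c)"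
      using A[OF i] by (rule F.int_pow_closed)
    show "induced_map (nerve (Zmod d)) (cyclic_hom (Zd_functions d c) (A i))
          \<in> simplicial_maps (nerve (Zmod d)) (N_complex d c (system_complex r c A))"
      unfolding N_complex_def
    proof (intro induced_map_simplicial F.cyclic_hom_hom A Ad i Z.is_group F.is_group, goal_cases)
      case (1 n h)
      have "0 \<le> k" if "k \<in> set h" for k
        using 1 that assms(1) by (auto simp: nerve_simps carrier_integer_mod_group)
      with 1 U[of h] cl show ?case
        by (auto simp: nerve_simps cyclic_hom_def simp del: carrier_product_group)
    qed
  qed (simp_all add: N nerve_simps N_complex_def induced_map_def system_complex_def)
  have eq: "nerve (Zmod d) = nerve (Zmod d)\<lparr>simplices := simplices (nerve (Zmod d))\<rparr>" by simp
  show "beta_map d r b \<in> simplicial_maps (NZ_wedge d r) (nerve (Zmod d))"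
    unfolding beta_map_def NZ_wedge_def
  proof (rule simplicial_map_wedge_map(1))
    fix i assume "i \<in> {..<r}"
    then have i: "i < r" by simp
    show "induced_map (nerve (Zmod d)) (cyclic_hom (Zmod d) (b i))
          \<in> simplicial_maps (nerve (Zmod d)) (nerve (Zmod d))"
      by (subst (3) eq, intro induced_map_simplicial Z.cyclic_hom_hom b bd i Z.is_group)
         (auto simp: nerve_simps cyclic_hom_def simp del: pow_integer_mod_group intro!: Z.int_pow_closed b i)
  qed (simp_all add: N nerve_simps induced_map_def)
qed

end

theory Submission
  imports Defs
begin

text \<open>A nerve records nothing beyond multiplication of pairs. A simplicial map \<open>f\<close> between simplicial
  subsets of nerves is determined by its values on edges, because outer faces isolate the entries
  of a tuple; and compatibility with the inner face of a \<open>2\<close>-simplex \<open>(s, t)\<close> says that the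
  function \<open>\<theta>\<close> on edges satisfies \<open>\<theta> (s t) = \<theta> s \<theta> t\<close>. Conversely, any \<open>\<theta>\<close> that is multiplicative on
  the pairs spanning a simplex of \<open>\<Sigma>\<close> induces a simplicial map. Torsion and commutation come for
  free: \<open>\<int>\<^sub>d\<^bsup>\<Sigma>\<^sub>0\<^esup>\<close> is abelian of exponent \<open>d\<close>, so multiplicativity forces \<open>(\<theta> s)\<^sup>d = 1\<close> and
  \<open>\<theta> s \<theta> t = \<theta> t \<theta> s\<close>. This identifies simplicial maps \<open>N(\<int>\<^sub>d, \<Sigma>) \<rightarrow> N(\<int>\<^sub>d, G)\<close> with
  such functions \<open>\<theta>\<close>, called simplexwise homomorphisms here (\<open>bij_induced_map\<close>).

  The function \<open>s\<close> is the sum of the \<open>s(v) \<delta>\<^sub>v\<close> over the vertices in its support, so \<open>\<theta>\<close> is in turn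
  determined by \<open>T v = \<theta> \<delta>\<^sub>v\<close>, where \<open>\<theta> s\<close> is the product of the powers \<open>T v ^ s(v)\<close>. The values of
  \<open>T\<close> can be any \<open>d\<close>-torsion elements that commute along the simplices of \<open>\<Sigma>\<close>
  (\<open>bij_linear_extension\<close>). For the complex of a linear system these are conditions (i) and (ii) on
  a solution, since its simplices other than single vertices lie in the support of a row.

  Finally, both \<open>f \<circ> \<alpha>\<close> and \<open>\<iota> \<circ> \<beta>\<close> are given on the \<open>i\<close>-th wedge factor by homomorphisms out of
  the cyclic group \<open>\<int>\<^sub>d\<close>, so they agree if and only if they agree on the generator, that is,
  \<open>\<theta> A\<^sub>i = J ^ b\<^sub>i\<close> (\<open>compatible_iff\<close>). As \<open>\<theta> A\<^sub>i\<close> is the product in condition (iii), the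
  composite \<open>T \<mapsto> \<theta> \<mapsto> f\<close> restricts to the required bijection.\<close>

section \<open>Ordered products in a group\<close>

lemma ordered_prod_Nil [simp]: "ordered_prod G f [] = \<one>\<^bsub>G\<^esub>"
  and ordered_prod_Cons [simp]: "ordered_prod G f (j # js) = f j \<otimes>\<^bsub>G\<^esub> ordered_prod G f js"
  by (simp_all add: ordered_prod_def)

lemma ordered_prod_cong:
  "(\<And>j. j \<in> set js \<Longrightarrow> f j = g j) \<Longrightarrow> ordered_prod G f js = ordered_prod G g js"
  by (induction js) auto

context group
begin

lemma ordered_prod_closed:
  "(\<And>j. j \<in> set js \<Longrightarrow> f j \<in> carrier G) \<Longrightarrow> ordered_prod G f js \<in> carrier G"
  by (induction js) auto

lemma ordered_prod_append:
  assumes "\<And>j. j \<in> set (js @ ks) \<Longrightarrow> f j \<in> carrier G"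
  shows "ordered_prod G f (js @ ks) = ordered_prod G f js \<otimes> ordered_prod G f ks"
  using assms by (induction js) (auto simp: ordered_prod_closed m_assoc)

lemma ordered_prod_filter_nontrivial:
  assumes "\<And>j. j \<in> set js \<Longrightarrow> f j \<in> carrier G" "\<And>j. j \<in> set js \<Longrightarrow> \<not> P j \<Longrightarrow> f j = \<one>"
  shows "ordered_prod G f (filter P js) = ordered_prod G f js"
  using assms by (induction js) (auto simp: ordered_prod_closed)

lemma commutes_ordered_prod:
  assumes "x \<in> carrier G" "\<And>j. j \<in> set js \<Longrightarrow> f j \<in> carrier G"
    and "\<And>j. j \<in> set js \<Longrightarrow> f j \<otimes> x = x \<otimes> f j"
  shows "ordered_prod G f js \<otimes> x = x \<otimes> ordered_prod G f js"
  using assms(2,3)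
proof (induction js)
  case (Cons j js)
  have c: "f j \<in> carrier G" "ordered_prod G f js \<in> carrier G"
    using Cons.prems by (auto intro: ordered_prod_closed)
  have "f j \<otimes> ordered_prod G f js \<otimes> x = f j \<otimes> (x \<otimes> ordered_prod G f js)"
    using Cons c assms(1) by (simp add: m_assoc)
  also have "\<dots> = x \<otimes> (f j \<otimes> ordered_prod G f js)"
    using Cons.prems c assms(1) by (simp flip: m_assoc)
  finally show ?case by simp
qed (use assms(1) in simp)

lemma ordered_prod_mult:
  assumes "\<And>j. j \<in> set js \<Longrightarrow> f j \<in> carrier G" "\<And>j. j \<in> set js \<Longrightarrow> g j \<in> carrier G"
    and "\<And>j k. j \<in> set js \<Longrightarrow> k \<in> set js \<Longrightarrow> f j \<otimes> g k = g k \<otimes> f j"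
  shows "ordered_prod G (\<lambda>j. f j \<otimes> g j) js = ordered_prod G f js \<otimes> ordered_prod G g js"
  using assms
proof (induction js)
  case (Cons j js)
  let ?F = "ordered_prod G f js" and ?H = "ordered_prod G g js"
  have c: "f j \<in> carrier G" "g j \<in> carrier G" "?F \<in> carrier G" "?H \<in> carrier G"
    using Cons.prems by (auto intro: ordered_prod_closed)
  have "?F \<otimes> g j = g j \<otimes> ?F"
    using Cons.prems c by (intro commutes_ordered_prod) auto
  then have "g j \<otimes> (?F \<otimes> ?H) = ?F \<otimes> (g j \<otimes> ?H)"
    using c by (simp flip: m_assoc)
  moreover have "ordered_prod G (\<lambda>j. f j \<otimes> g j) js = ?F \<otimes> ?H"
    by (intro Cons.IH Cons.prems list.set_intros)
  ultimately show ?case using c by (simp add: m_assoc)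
qed simp

lemma int_pow_commute:
  assumes "x \<in> carrier G" "y \<in> carrier G" "x \<otimes> y = y \<otimes> x"
  shows "x [^] (m::int) \<otimes> y [^] (n::int) = y [^] n \<otimes> x [^] m"
proof -
  have *: "u [^] (m::int) \<otimes> v = v \<otimes> u [^] m"
    if "u \<in> carrier G" "v \<in> carrier G" "u \<otimes> v = v \<otimes> u" for u v m
  proof -
    have p: "u [^] (k::nat) \<otimes> v = v \<otimes> u [^] k" for k
      using group_commutes_pow that by blast
    have "inv (u [^] k) \<otimes> v = v \<otimes> inv (u [^] k)" for k :: nat
    proof -
      have "u [^] k \<otimes> (v \<otimes> inv (u [^] k)) = v"
        using p[of k] that by (simp add: inv_solve_right' flip: m_assoc)
      then show ?thesis using that by (metis inv_closed inv_solve_left m_closed nat_pow_closed)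
    qed
    with p show ?thesis unfolding int_pow_def2 by presburger
  qed
  show ?thesis
    by (intro *[of x "y [^] n" m] *[of y x n, symmetric] int_pow_closed assms assms(3)[symmetric])
qed

end


section \<open>Simplicial maps between nerves\<close>

text \<open>The first and the last face map drop the first and the last entry of a tuple, so iterating
  them isolates each entry of an \<open>n\<close>-simplex as an edge.\<close>

lemma simplicial_map_determined_by_edges:
  assumes f: "f \<in> simplicial_maps (nerve H\<lparr>simplices := S\<rparr>) (nerve K\<lparr>simplices := S'\<rparr>)"
    and X: "simplicial_set (nerve H\<lparr>simplices := S\<rparr>)"
    and S: "\<And>n h. h \<in> S n \<Longrightarrow> length h = n" and S': "\<And>n h. h \<in> S' n \<Longrightarrow> length h = n"
    and h: "h \<in> S n"
  shows "f n h = map (\<lambda>s. hd (f 1 [s])) h"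
  using h
proof (induction n arbitrary: h rule: nat_induct)
  case 0
  have "f 0 h \<in> S' 0" using f 0 by (auto simp: simplicial_maps_def)
  then show ?case using S[OF 0] S' by auto
next
  case (Suc n)
  have fS: "f (Suc n) h \<in> S' (Suc n)" using f Suc.prems by (auto simp: simplicial_maps_def)
  have len: "length h = Suc n" "length (f (Suc n) h) = Suc n" using S[OF Suc.prems] S'[OF fS] .
  show ?case
  proof (cases n)
    case 0
    then obtain s where "h = [s]" using len by (cases h) auto
    then show ?thesis using len 0 by (cases "f 1 [s]") auto
  next
    case (Suc m)
    let ?\<theta> = "\<lambda>s. hd (f 1 [s])"
    have cl: "tl h \<in> S n" "butlast h \<in> S n"
      using simplicial_set.face_closed[OF X, of h n 0] simplicial_set.face_closed[OF X, of h n "Suc n"]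
        Suc.prems by (auto simp: nerve_def)
    have "f n (face (nerve H) (Suc n) i h) = face (nerve K) (Suc n) i (f (Suc n) h)" if "i \<le> Suc n" for i
      using f Suc.prems that by (auto simp: simplicial_maps_def)
    from this[of 0] this[of "Suc n"]
    have "tl (f (Suc n) h) = f n (tl h)" "butlast (f (Suc n) h) = f n (butlast h)"
      by (auto simp: nerve_def)
    then have t: "tl (f (Suc n) h) = map ?\<theta> (tl h)" and b: "butlast (f (Suc n) h) = map ?\<theta> (butlast h)"
      using Suc.IH cl by auto
    obtain a as where a: "f (Suc n) h = a # as" using len by (cases "f (Suc n) h") auto
    obtain s ss where s: "h = s # ss" using len by (cases h) auto
    (* n >= 1, so the tuples have length at least 2: the tail and the entries other than the last
       one together cover all positions. *)
    from a s t b len Suc show ?thesis by (auto split: if_splits)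
  qed
qed


section \<open>Simplexwise homomorphisms\<close>

text \<open>The \<open>1\<close>-simplices of \<open>N(\<int>\<^sub>d, \<Sigma>)\<close>, without the list brackets.\<close>

definition edge_functions :: "nat \<Rightarrow> nat \<Rightarrow> nat set set \<Rightarrow> (nat \<Rightarrow> int) set" where
  "edge_functions d c \<Sigma> = {s \<in> carrier (Zd_functions d c). supp c s \<in> \<Sigma>}"

text \<open>Membership in \<open>\<rightarrow>\<^sub>E\<close> makes the values outside of the edges canonical, so that equality of these
  functions is equality of the edge maps of simplicial maps.\<close>

definition simplexwise_homs ::
    "nat \<Rightarrow> nat \<Rightarrow> nat set set \<Rightarrow> ('g, 'm) monoid_scheme \<Rightarrow> ((nat \<Rightarrow> int) \<Rightarrow> 'g) set" where
  "simplexwise_homs d c \<Sigma> G = {\<theta> \<in> edge_functions d c \<Sigma> \<rightarrow>\<^sub>E carrier G.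
     \<forall>s \<in> carrier (Zd_functions d c). \<forall>t \<in> carrier (Zd_functions d c). supp c s \<union> supp c t \<in> \<Sigma> \<longrightarrow>
       \<theta> (s \<otimes>\<^bsub>Zd_functions d c\<^esub> t) = \<theta> s \<otimes>\<^bsub>G\<^esub> \<theta> t}"

text \<open>Solutions of a linear system before the equations (iii) of its rows are imposed.\<close>

definition commuting_assignments ::
    "nat \<Rightarrow> nat \<Rightarrow> nat set set \<Rightarrow> ('g, 'm) monoid_scheme \<Rightarrow> (nat \<Rightarrow> 'g) set" where
  "commuting_assignments d c \<Sigma> G = {T \<in> {..<c} \<rightarrow>\<^sub>E carrier G.
     (\<forall>j<c. T j [^]\<^bsub>G\<^esub> d = \<one>\<^bsub>G\<^esub>) \<and>
     (\<forall>\<sigma>\<in>\<Sigma>. \<forall>j\<in>\<sigma>. \<forall>k\<in>\<sigma>. T j \<otimes>\<^bsub>G\<^esub> T k = T k \<otimes>\<^bsub>G\<^esub> T j)}"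

definition delta :: "nat \<Rightarrow> nat \<Rightarrow> nat \<Rightarrow> int" where
  "delta c j = (\<lambda>k\<in>{..<c}. if k = j then 1 else 0)"

text \<open>For \<open>s = A\<^sub>i\<close> this is literally the left-hand side of condition (iii) on a solution.\<close>

definition linear_extension ::
    "nat \<Rightarrow> nat \<Rightarrow> nat set set \<Rightarrow> ('g, 'm) monoid_scheme \<Rightarrow> (nat \<Rightarrow> 'g) \<Rightarrow> (nat \<Rightarrow> int) \<Rightarrow> 'g" where
  "linear_extension d c \<Sigma> G T = (\<lambda>s\<in>edge_functions d c \<Sigma>.
     ordered_prod G (\<lambda>j. T j [^]\<^bsub>G\<^esub> s j) (sorted_list_of_set (supp c s)))"

text \<open>The properties of the complex of a linear system on which the description of simplicial maps
  rests.\<close>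

locale complex_and_group = group G for G (structure) +
  fixes d c :: nat and \<Sigma> :: "nat set set"
  assumes d_gt_1: "1 < d"
    and subset_closed: "\<sigma> \<in> \<Sigma> \<Longrightarrow> \<tau> \<subseteq> \<sigma> \<Longrightarrow> \<tau> \<in> \<Sigma>"
    and empty_simplex: "{} \<in> \<Sigma>"
    and vertex_simplex: "j < c \<Longrightarrow> {j} \<in> \<Sigma>"
    and simplex_vertices: "\<sigma> \<in> \<Sigma> \<Longrightarrow> \<sigma> \<subseteq> {..<c}"
begin

abbreviation F where "F \<equiv> Zd_functions d c"

sublocale F: comm_group F
proof (rule group.group_comm_groupI)
  show "group F" by simp
  show "x \<otimes>\<^bsub>F\<^esub> y = y \<otimes>\<^bsub>F\<^esub> x" for x y by (simp add: add.commute)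
qed

lemma simplexwise_homD:
  assumes "\<theta> \<in> simplexwise_homs d c \<Sigma> G"
  shows simplexwise_hom_extensional: "\<theta> \<in> edge_functions d c \<Sigma> \<rightarrow>\<^sub>E carrier G"
    and simplexwise_hom_mult: "\<lbrakk>s \<in> carrier F; t \<in> carrier F; supp c s \<union> supp c t \<in> \<Sigma>\<rbrakk> \<Longrightarrow>
      \<theta> (s \<otimes>\<^bsub>F\<^esub> t) = \<theta> s \<otimes> \<theta> t"
    and simplexwise_hom_closed: "\<lbrakk>s \<in> carrier F; supp c s \<in> \<Sigma>\<rbrakk> \<Longrightarrow> \<theta> s \<in> carrier G"
  using assms
  by (auto simp: simplexwise_homs_def edge_functions_def simp del: carrier_product_group mult_product_group)

lemma simplexwise_hom_one:
  assumes "\<theta> \<in> simplexwise_homs d c \<Sigma> G"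
  shows "\<theta> \<one>\<^bsub>F\<^esub> = \<one>"
proof -
  have "\<theta> (\<one>\<^bsub>F\<^esub> \<otimes>\<^bsub>F\<^esub> \<one>\<^bsub>F\<^esub>) = \<theta> \<one>\<^bsub>F\<^esub> \<otimes> \<theta> \<one>\<^bsub>F\<^esub>"
    by (rule simplexwise_hom_mult[OF assms F.one_closed F.one_closed]) (simp only: supp_one Un_empty_left empty_simplex)
  moreover have "\<theta> \<one>\<^bsub>F\<^esub> \<in> carrier G"
    by (rule simplexwise_hom_closed[OF assms F.one_closed]) (simp only: supp_one empty_simplex)
  ultimately show ?thesis by (simp only: F.r_one F.one_closed r_cancel_one')
qed

lemma supp_pow: "supp c (s [^]\<^bsub>F\<^esub> (n::nat)) \<subseteq> supp c s" if "s \<in> carrier F"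
  unfolding Zd_functions_pow[OF that] by (auto simp: supp_def)

lemma simplexwise_hom_pow:
  assumes \<theta>: "\<theta> \<in> simplexwise_homs d c \<Sigma> G" and s: "s \<in> carrier F" "supp c s \<in> \<Sigma>"
  shows "\<theta> (s [^]\<^bsub>F\<^esub> (n::nat)) = \<theta> s [^] n"
proof (induction n)
  case 0
  show ?case using simplexwise_hom_one[OF \<theta>] by (simp only: F.nat_pow_0 nat_pow_0)
next
  case (Suc n)
  have "\<theta> (s [^]\<^bsub>F\<^esub> n \<otimes>\<^bsub>F\<^esub> s) = \<theta> (s [^]\<^bsub>F\<^esub> n) \<otimes> \<theta> s"
    using supp_pow[OF s(1), of n] s
    by (intro simplexwise_hom_mult[OF \<theta>] F.nat_pow_closed) (simp_all only: Un_absorb1)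
  then show ?case using Suc by (simp only: F.nat_pow_Suc nat_pow_Suc)
qed

text \<open>The source group has exponent \<open>d\<close>, and powers of \<open>s\<close> stay on the simplex that supports \<open>s\<close>.\<close>

lemma simplexwise_hom_torsion:
  assumes \<theta>: "\<theta> \<in> simplexwise_homs d c \<Sigma> G" and s: "s \<in> carrier F" "supp c s \<in> \<Sigma>"
  shows "\<theta> s [^] d = \<one>"
proof -
  have "s [^]\<^bsub>F\<^esub> d = \<one>\<^bsub>F\<^esub>" using Zd_functions_pow[OF s(1), of d] by simp
  then show ?thesis using simplexwise_hom_pow[OF assms, of d] simplexwise_hom_one[OF \<theta>] by argo
qed

text \<open>The product \<open>s t = t s\<close> is computed in an abelian group, so \<open>\<theta>\<close> can be applied to it in both orders.\<close>

lemma simplexwise_hom_commute: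
  assumes \<theta>: "\<theta> \<in> simplexwise_homs d c \<Sigma> G"
    and "s \<in> carrier F" "t \<in> carrier F" "supp c s \<union> supp c t \<in> \<Sigma>"
  shows "\<theta> s \<otimes> \<theta> t = \<theta> t \<otimes> \<theta> s"
proof -
  have "\<theta> s \<otimes> \<theta> t = \<theta> (s \<otimes>\<^bsub>F\<^esub> t)" by (rule simplexwise_hom_mult[OF assms, symmetric])
  also have "\<dots> = \<theta> (t \<otimes>\<^bsub>F\<^esub> s)" by (rule arg_cong[OF F.m_comm[OF assms(2,3)]])
  also have "\<dots> = \<theta> t \<otimes> \<theta> s"
    by (rule simplexwise_hom_mult[OF \<theta> assms(3,2)]) (use assms(4) in \<open>simp only: Un_commute\<close>)
  finally show ?thesis .
qed

subsection \<open>Simplicial maps as simplexwise homomorphisms\<close>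

abbreviation X where "X \<equiv> N_complex d c \<Sigma>"
abbreviation Y where "Y \<equiv> N_torsion d G"

lemma simplicial_X: "simplicial_set X"
  by (rule simplicial_set_N_complex) (rule subset_closed)

lemma X_iff: "h \<in> simplices X n \<longleftrightarrow> length h = n \<and> set h \<subseteq> carrier F \<and> (\<Union>s\<in>set h. supp c s) \<in> \<Sigma>"
  unfolding N_complex_def by (simp add: nerve_simps del: carrier_product_group)

lemma Y_iff: "h \<in> simplices Y n \<longleftrightarrow> length h = n \<and> set h \<subseteq> carrier G \<and>
    (\<forall>g\<in>set h. g [^] d = \<one>) \<and> (\<forall>g\<in>set h. \<forall>g'\<in>set h. g \<otimes> g' = g' \<otimes> g)"
  unfolding N_torsion_def by (simp add: nerve_simps)

lemma X_ops: "face X = face (nerve F)" "degen X = degen (nerve F)"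
  and Y_ops: "face Y = face (nerve G)" "degen Y = degen (nerve G)"
  by (simp_all add: N_complex_def N_torsion_def)

lemma X_pair:
  assumes "h \<in> simplices X n" "s \<in> set h" "t \<in> set h"
  shows "s \<in> carrier F" "t \<in> carrier F" "supp c s \<union> supp c t \<in> \<Sigma>" "supp c s \<in> \<Sigma>"
  using assms subset_closed[of "\<Union>s\<in>set h. supp c s"] unfolding X_iff by (blast | auto)+

text \<open>Inner faces multiply neighbouring entries, whose supports lie in one simplex, so
  \<open>\<theta>\<close> is multiplicative on them; degeneracies insert the identity, which \<open>\<theta>\<close> preserves.\<close>

lemma induced_map_simplicial_map:
  assumes \<theta>: "\<theta> \<in> simplexwise_homs d c \<Sigma> G"
  shows "induced_map X \<theta> \<in> simplicial_maps X Y"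
proof -
  have Y: "map \<theta> h \<in> simplices Y n" if h: "h \<in> simplices X n" for h n
    using X_pair[OF h] simplexwise_hom_closed[OF \<theta>] simplexwise_hom_torsion[OF \<theta>] simplexwise_hom_commute[OF \<theta>] h
    unfolding Y_iff by (auto simp del: carrier_product_group simp: X_iff)
  note s = length_face_nerve length_degen_nerve nth_face_nerve nth_degen_nerve
  have fc: "map \<theta> (face X (Suc n) i h) = face Y (Suc n) i (map \<theta> h)"
    if h: "h \<in> simplices X (Suc n)" "i \<le> Suc n" for h i n
  proof (rule nth_equalityI)
    have l: "length h = Suc n" using h by (simp add: X_iff)
    show "length (map \<theta> (face X (Suc n) i h)) = length (face Y (Suc n) i (map \<theta> h))"
      using h l by (simp add: X_ops Y_ops s)
    fix k assume "k < length (map \<theta> (face X (Suc n) i h))"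
    then have k: "k < n" using h l by (simp add: X_ops s)
    have "\<theta> (h ! k \<otimes>\<^bsub>F\<^esub> h ! Suc k) = \<theta> (h ! k) \<otimes> \<theta> (h ! Suc k)"
      using X_pair[OF h(1), of "h ! k" "h ! Suc k"] l k by (intro simplexwise_hom_mult[OF \<theta>]) simp_all
    then show "map \<theta> (face X (Suc n) i h) ! k = face Y (Suc n) i (map \<theta> h) ! k"
      using h l k by (cases "Suc k = i") (auto simp: X_ops Y_ops s simp del: mult_product_group)
  qed
  have dg: "map \<theta> (degen X n j h) = degen Y n j (map \<theta> h)"
    if h: "h \<in> simplices X n" "j \<le> n" for h j n
    using h simplexwise_hom_one[OF \<theta>] by (intro nth_equalityI) (auto simp: X_iff X_ops Y_ops s simp del: one_product_group)
  show ?thesis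
    using Y fc dg simplicial_set.face_closed[OF simplicial_X] simplicial_set.degen_closed[OF simplicial_X]
    unfolding simplicial_maps_def induced_map_def by auto
qed

text \<open>Multiplicativity of the edge map is read off from the inner face of the \<open>2\<close>-simplices.\<close>

lemma simplicial_map_is_induced:
  assumes f: "f \<in> simplicial_maps X Y"
  defines "\<theta> \<equiv> \<lambda>s\<in>edge_functions d c \<Sigma>. hd (f 1 [s])"
  shows "\<theta> \<in> simplexwise_homs d c \<Sigma> G" "f = induced_map X \<theta>"
proof -
  have fm: "f n h = map (\<lambda>s. hd (f 1 [s])) h" if "h \<in> simplices X n" for n h
  proof (rule simplicial_map_determined_by_edges)
    show "f \<in> simplicial_maps (nerve F\<lparr>simplices := simplices X\<rparr>) (nerve G\<lparr>simplices := simplices Y\<rparr>)"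
      using f by (simp add: N_complex_def N_torsion_def)
    show "simplicial_set (nerve F\<lparr>simplices := simplices X\<rparr>)"
      using simplicial_X by (simp add: N_complex_def)
  qed (use that in \<open>auto simp: X_iff Y_iff simp del: carrier_product_group\<close>)
  have f\<theta>: "f n h = map \<theta> h" if h: "h \<in> simplices X n" for n h
    unfolding fm[OF h] \<theta>_def using X_pair[OF h]
    by (auto simp: edge_functions_def simp del: carrier_product_group)
  have fY: "f n h \<in> simplices Y n" if "h \<in> simplices X n" for n h
    using f that by (auto simp: simplicial_maps_def)
  have e: "\<theta> s \<in> carrier G" if "s \<in> edge_functions d c \<Sigma>" for s
    using f\<theta>[of "[s]" 1] fY[of "[s]" 1] that
    by (auto simp: edge_functions_def X_iff Y_iff simp del: carrier_product_group)
  have m: "\<theta> (s \<otimes>\<^bsub>F\<^esub> t) = \<theta> s \<otimes> \<theta> t"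
    if st: "s \<in> carrier F" "t \<in> carrier F" "supp c s \<union> supp c t \<in> \<Sigma>" for s t
  proof -
    have x: "[s, t] \<in> simplices X (Suc 1)" using st by (simp add: X_iff del: carrier_product_group)
    then have "face X (Suc 1) 1 [s, t] \<in> simplices X 1"
      by (rule simplicial_set.face_closed[OF simplicial_X]) simp
    moreover have "face X (Suc 1) 1 [s, t] = [s \<otimes>\<^bsub>F\<^esub> t]"
      "face Y (Suc 1) 1 [\<theta> s, \<theta> t] = [\<theta> s \<otimes> \<theta> t]"
      unfolding X_ops Y_ops by (simp_all add: nerve_def)
    moreover have "f 1 (face X (Suc 1) 1 [s, t]) = face Y (Suc 1) 1 (f (Suc 1) [s, t])"
      using f x unfolding simplicial_maps_def by fastforce
    ultimately show ?thesis using f\<theta>[OF x] f\<theta>[of "[s \<otimes>\<^bsub>F\<^esub> t]" 1] by simp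
  qed
  show "\<theta> \<in> simplexwise_homs d c \<Sigma> G"
    unfolding simplexwise_homs_def using e m by (auto simp: \<theta>_def)
  show "f = induced_map X \<theta>"
  proof (rule ext)
    fix n
    have "f n \<in> extensional (simplices X n)" using f by (auto simp: simplicial_maps_def PiE_def)
    then show "f n = induced_map X \<theta> n"
      unfolding induced_map_def by (intro extensionalityI[of _ "simplices X n"]) (simp_all add: f\<theta>)
  qed
qed

lemma bij_induced_map:
  "bij_betw (induced_map X) (simplexwise_homs d c \<Sigma> G) (simplicial_maps X Y)"
  unfolding bij_betw_def
proof
  show "inj_on (induced_map X) (simplexwise_homs d c \<Sigma> G)"
  proof (rule inj_onI)
    fix \<theta> \<eta> assume h: "\<theta> \<in> simplexwise_homs d c \<Sigma> G" "\<eta> \<in> simplexwise_homs d c \<Sigma> G"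
      and eq: "induced_map X \<theta> = induced_map X \<eta>"
    have "\<theta> s = \<eta> s" if "s \<in> edge_functions d c \<Sigma>" for s
    proof -
      have "[s] \<in> simplices X 1"
        using that by (simp add: edge_functions_def X_iff del: carrier_product_group)
      then show ?thesis using fun_cong[OF fun_cong[OF eq, of 1], of "[s]"] by (simp add: induced_map_def)
    qed
    then show "\<theta> = \<eta>" using h[THEN simplexwise_hom_extensional] by (rule PiE_ext[rotated 2])
  qed
  show "induced_map X ` simplexwise_homs d c \<Sigma> G = simplicial_maps X Y"
    using induced_map_simplicial_map simplicial_map_is_induced by blast
qed

subsection \<open>Simplexwise homomorphisms as commuting assignments\<close>

lemma carrier_bounds: "s \<in> carrier F \<Longrightarrow> j < c \<Longrightarrow> 0 \<le> s j \<and> s j < int d"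
  using d_gt_1 by (auto simp: PiE_iff carrier_integer_mod_group)

lemma delta_closed: "delta c j \<in> carrier F"
  using d_gt_1 by (auto simp: delta_def carrier_integer_mod_group)

lemma supp_delta: "j < c \<Longrightarrow> supp c (delta c j) = {j}"
  by (auto simp: delta_def supp_def)

text \<open>Vertices outside of the support contribute \<open>T(v)\<^sup>0 = 1\<close>. With one index list common to all \<open>s\<close>, the
  products for \<open>s\<close> and \<open>t\<close> can be multiplied factor by factor.\<close>

lemma linear_extension_all_vertices:
  assumes T: "T \<in> commuting_assignments d c \<Sigma> G" and s: "s \<in> edge_functions d c \<Sigma>"
  shows "linear_extension d c \<Sigma> G T s = ordered_prod G (\<lambda>j. T j [^] s j) [0..<c]"
proof -
  have "sorted_list_of_set (supp c s) = filter (\<lambda>j. s j \<noteq> 0) [0..<c]"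
    by (rule sorted_distinct_set_unique) (auto simp: supp_def sorted_wrt_filter)
  moreover have "ordered_prod G (\<lambda>j. T j [^] s j) (filter (\<lambda>j. s j \<noteq> 0) [0..<c])
      = ordered_prod G (\<lambda>j. T j [^] s j) [0..<c]"
    using T by (intro ordered_prod_filter_nontrivial) (auto simp: commuting_assignments_def)
  ultimately show ?thesis using s by (simp add: linear_extension_def)
qed

text \<open>Two powers \<open>T(v)\<^bsup>s(v)\<^esup>\<close> and \<open>T(w)\<^bsup>t(w)\<^esup>\<close> commute: either one of them is trivial or \<open>v\<close> and \<open>w\<close> lie in
  the simplex spanned by the supports of \<open>s\<close> and \<open>t\<close>. Reduction of exponents modulo \<open>d\<close> is harmless
  by torsion.\<close>

lemma linear_extension_hom:
  assumes T: "T \<in> commuting_assignments d c \<Sigma> G"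
  shows "linear_extension d c \<Sigma> G T \<in> simplexwise_homs d c \<Sigma> G"
proof -
  let ?L = "linear_extension d c \<Sigma> G T"
  have Tc: "T j \<in> carrier G" "T j [^] d = \<one>" if "j < c" for j
    using T that by (auto simp: commuting_assignments_def)
  have Lc: "?L s \<in> carrier G" if "s \<in> edge_functions d c \<Sigma>" for s
    unfolding linear_extension_all_vertices[OF T that] by (intro ordered_prod_closed) (simp add: Tc)
  have Lm: "?L (s \<otimes>\<^bsub>F\<^esub> t) = ?L s \<otimes> ?L t"
    if st: "s \<in> carrier F" "t \<in> carrier F" "supp c s \<union> supp c t \<in> \<Sigma>" for s t
  proof -
    have E: "s \<in> edge_functions d c \<Sigma>" "t \<in> edge_functions d c \<Sigma>" "s \<otimes>\<^bsub>F\<^esub> t \<in> edge_functions d c \<Sigma>"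
      using st subset_closed[OF st(3)] supp_mult[of c d s t] F.m_closed[of s t]
      unfolding edge_functions_def by blast+
    have com: "T j [^] s j \<otimes> T k [^] t k = T k [^] t k \<otimes> T j [^] s j" if "j < c" "k < c" for j k
    proof (cases "s j = 0 \<or> t k = 0")
      case True
      then show ?thesis using Tc that by auto
    next
      case False
      then have "j \<in> supp c s \<union> supp c t" "k \<in> supp c s \<union> supp c t" using that by (auto simp: supp_def)
      then have "T j \<otimes> T k = T k \<otimes> T j" using T st(3) by (auto simp: commuting_assignments_def)
      then show ?thesis using Tc that by (intro int_pow_commute)
    qed
    have "T j [^] (s \<otimes>\<^bsub>F\<^esub> t) j = T j [^] s j \<otimes> T j [^] t j" if "j < c" for j
    proof -
      have "s j \<in> carrier (Zmod d)" "t j \<in> carrier (Zmod d)" using st that by auto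
      from Group.hom_mult[OF cyclic_hom_hom[OF Tc[OF that]] this]
      show ?thesis using that by (simp add: cyclic_hom_def)
    qed
    then have "ordered_prod G (\<lambda>j. T j [^] (s \<otimes>\<^bsub>F\<^esub> t) j) [0..<c]
        = ordered_prod G (\<lambda>j. T j [^] s j \<otimes> T j [^] t j) [0..<c]"
      by (intro ordered_prod_cong) simp
    also have "\<dots> = ordered_prod G (\<lambda>j. T j [^] s j) [0..<c] \<otimes> ordered_prod G (\<lambda>j. T j [^] t j) [0..<c]"
      by (intro ordered_prod_mult) (simp_all add: Tc com)
    finally show ?thesis unfolding E[THEN linear_extension_all_vertices[OF T]] .
  qed
  show ?thesis unfolding simplexwise_homs_def using Lc Lm by (auto simp: linear_extension_def)
qed

lemma linear_extension_delta:
  assumes T: "T \<in> commuting_assignments d c \<Sigma> G" and j: "j < c"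
  shows "linear_extension d c \<Sigma> G T (delta c j) = T j"
proof -
  have "T j \<in> carrier G" using assms by (auto simp: commuting_assignments_def)
  moreover have "delta c j \<in> edge_functions d c \<Sigma>"
    using delta_closed j by (simp add: edge_functions_def supp_delta vertex_simplex del: carrier_product_group)
  moreover have "delta c j j = 1" using j by (simp add: delta_def)
  ultimately show ?thesis using j by (simp add: linear_extension_def supp_delta int_pow_1)
qed

lemma hom_values_commuting:
  assumes \<theta>: "\<theta> \<in> simplexwise_homs d c \<Sigma> G"
  shows "(\<lambda>j\<in>{..<c}. \<theta> (delta c j)) \<in> commuting_assignments d c \<Sigma> G"
proof -
  have 1: "\<theta> (delta c j) \<in> carrier G" "\<theta> (delta c j) [^] d = \<one>" if "j < c" for j
    using that by (simp_all add: simplexwise_hom_closed[OF \<theta> delta_closed]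
        simplexwise_hom_torsion[OF \<theta> delta_closed] supp_delta vertex_simplex)
  have 2: "\<theta> (delta c j) \<otimes> \<theta> (delta c k) = \<theta> (delta c k) \<otimes> \<theta> (delta c j)"
    if "\<sigma> \<in> \<Sigma>" "j \<in> \<sigma>" "k \<in> \<sigma>" for \<sigma> j k
  proof (rule simplexwise_hom_commute[OF \<theta> delta_closed delta_closed])
    have "j < c" "k < c" using simplex_vertices that by auto
    then have "supp c (delta c j) \<union> supp c (delta c k) = {j, k}" by (auto simp: supp_delta)
    then show "supp c (delta c j) \<union> supp c (delta c k) \<in> \<Sigma>" using that by (auto intro: subset_closed)
  qed
  have "j < c" if "\<sigma> \<in> \<Sigma>" "j \<in> \<sigma>" for \<sigma> j using simplex_vertices that by auto
  with 1 2 show ?thesis unfolding commuting_assignments_def by simp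
qed

text \<open>Build \<open>s\<close> up one vertex at a time: every partial sum of \<open>s = \<Sum>\<^sub>v s(v) \<delta>\<^sub>v\<close> is supported in the support
  of \<open>s\<close>, so \<open>\<theta>\<close> is multiplicative at each step.\<close>

lemma hom_eq_linear_extension:
  assumes \<theta>: "\<theta> \<in> simplexwise_homs d c \<Sigma> G"
  shows "linear_extension d c \<Sigma> G (\<lambda>j\<in>{..<c}. \<theta> (delta c j)) = \<theta>"
proof (rule PiE_ext)
  show "linear_extension d c \<Sigma> G (\<lambda>j\<in>{..<c}. \<theta> (delta c j)) \<in> edge_functions d c \<Sigma> \<rightarrow>\<^sub>E carrier G"
    by (intro simplexwise_hom_extensional linear_extension_hom hom_values_commuting \<theta>)
  show "\<theta> \<in> edge_functions d c \<Sigma> \<rightarrow>\<^sub>E carrier G" by (rule simplexwise_hom_extensional[OF \<theta>])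
  fix s assume sE: "s \<in> edge_functions d c \<Sigma>"
  then have s: "s \<in> carrier F" "supp c s \<in> \<Sigma>" by (auto simp: edge_functions_def)
  (* the partial sum of s over the vertices below m *)
  define tr where "tr m = (\<lambda>j\<in>{..<c}. if j < m then s j else 0)" for m
  have "s j \<in> carrier (Zmod d)" if "j < c" for j using s(1) that by (simp add: PiE_iff)
  then have trF: "tr m \<in> carrier F" for m by (simp add: tr_def PiE_iff)
  have "\<theta> (tr m) = ordered_prod G (\<lambda>j. \<theta> (delta c j) [^] s j) [0..<m]" if "m \<le> c" for m
    using that
  proof (induction m)
    case 0
    have "tr 0 = \<one>\<^bsub>F\<^esub>" by (auto simp: tr_def)
    then have "\<theta> (tr 0) = \<one>" by (simp only: simplexwise_hom_one[OF \<theta>])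
    then show ?case by simp
  next
    case (Suc m)
    then have m: "m < c" by simp
    define k where "k = nat (s m)"
    have k: "s m = int k" "k < d" using carrier_bounds[OF s(1) m] by (auto simp: k_def)
    let ?e = "delta c m [^]\<^bsub>F\<^esub> k"
    have e: "?e = (\<lambda>j\<in>{..<c}. if j = m then s m else 0)"
      unfolding Zd_functions_pow[OF delta_closed] using k by (auto simp: delta_def)
    have split: "tr (Suc m) = tr m \<otimes>\<^bsub>F\<^esub> ?e"
      unfolding e using carrier_bounds[OF s(1)] by (auto simp: tr_def fun_eq_iff)
    have "\<theta> (tr m \<otimes>\<^bsub>F\<^esub> ?e) = \<theta> (tr m) \<otimes> \<theta> ?e"
    proof (rule simplexwise_hom_mult[OF \<theta> trF F.nat_pow_closed[OF delta_closed]])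
      (* If s m = 0 then ?e is the identity, so the vertex m enters only if it supports s. *)
      have "supp c (tr m) \<union> supp c ?e \<subseteq> supp c s" unfolding e by (auto simp: tr_def supp_def)
      then show "supp c (tr m) \<union> supp c ?e \<in> \<Sigma>" by (rule subset_closed[OF s(2)])
    qed
    then have "\<theta> (tr (Suc m)) = \<theta> (tr m) \<otimes> \<theta> ?e"
      by (simp only: split)
    moreover have "\<theta> ?e = \<theta> (delta c m) [^] s m"
      unfolding k int_pow_int by (rule simplexwise_hom_pow[OF \<theta> delta_closed]) (simp add: supp_delta vertex_simplex m)
    moreover have "ordered_prod G (\<lambda>j. \<theta> (delta c j) [^] s j) ([0..<m] @ [m])
        = ordered_prod G (\<lambda>j. \<theta> (delta c j) [^] s j) [0..<m] \<otimes> \<theta> (delta c m) [^] s m"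
    proof -
      have cl: "\<theta> (delta c j) \<in> carrier G" if "j < c" for j
        using that by (intro simplexwise_hom_closed[OF \<theta> delta_closed]) (simp add: supp_delta vertex_simplex)
      show ?thesis using m by (subst ordered_prod_append) (auto simp: cl)
    qed
    ultimately show ?case using Suc.IH m by simp
  qed
  from this[of c] have "\<theta> (tr c) = ordered_prod G (\<lambda>j. \<theta> (delta c j) [^] s j) [0..<c]" by simp
  moreover have "tr c = s" using s(1) by (auto simp: tr_def PiE_iff extensional_def fun_eq_iff)
  moreover have "ordered_prod G (\<lambda>j. (\<lambda>j\<in>{..<c}. \<theta> (delta c j)) j [^] s j) [0..<c]
      = ordered_prod G (\<lambda>j. \<theta> (delta c j) [^] s j) [0..<c]"
    by (intro ordered_prod_cong) simp
  ultimately show "linear_extension d c \<Sigma> G (\<lambda>j\<in>{..<c}. \<theta> (delta c j)) s = \<theta> s"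
    unfolding linear_extension_all_vertices[OF hom_values_commuting[OF \<theta>] sE] by simp
qed

lemma bij_linear_extension:
  "bij_betw (linear_extension d c \<Sigma> G) (commuting_assignments d c \<Sigma> G) (simplexwise_homs d c \<Sigma> G)"
proof (rule bij_betw_byWitness[where f' = "\<lambda>\<theta>. \<lambda>j\<in>{..<c}. \<theta> (delta c j)"])
  show "\<forall>T\<in>commuting_assignments d c \<Sigma> G. (\<lambda>j\<in>{..<c}. linear_extension d c \<Sigma> G T (delta c j)) = T"
  proof
    fix T assume T: "T \<in> commuting_assignments d c \<Sigma> G"
    then have "T \<in> extensional {..<c}" by (auto simp: commuting_assignments_def PiE_def)
    then show "(\<lambda>j\<in>{..<c}. linear_extension d c \<Sigma> G T (delta c j)) = T"
      by (intro extensionalityI[of _ "{..<c}"]) (simp_all add: linear_extension_delta[OF T])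
  qed
qed (blast intro: hom_eq_linear_extension linear_extension_hom hom_values_commuting)+

end


section \<open>Maps out of the wedge and the equations of the rows\<close>

lemma base_simplex_nerve: "base_simplex (nerve H\<lparr>simplices := S\<rparr>) [] n = replicate n \<one>\<^bsub>H\<^esub>"
  by (induction n) (simp_all add: nerve_def)

lemma base_simplex_full_nerve: "base_simplex (nerve H) [] n = replicate n \<one>\<^bsub>H\<^esub>"
  by (induction n) (simp_all add: nerve_def)

lemma simplicial_comp_wedge_eq_iff:
  "simplicial_comp (wedge I X x0) p q = simplicial_comp (wedge I X x0) p' q' \<longleftrightarrow>
    (\<forall>n. p n (q n None) = p' n (q' n None)) \<and>
    (\<forall>n. \<forall>i\<in>I. \<forall>x\<in>simplices (X i) n. p n (q n (wedge_in X x0 i n x)) = p' n (q' n (wedge_in X x0 i n x)))"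
  (is "?l \<longleftrightarrow> ?r")
proof
  assume ?l
  then have "compose (simplices (wedge I X x0) n) (p n) (q n) w = compose (simplices (wedge I X x0) n) (p' n) (q' n) w"
    for n w by (auto simp: simplicial_comp_def fun_eq_iff)
  note w = this[unfolded compose_def]
  show ?r
  proof (intro conjI allI ballI)
    show "p n (q n None) = p' n (q' n None)" for n using w[of n None] by (simp add: wedge_simps)
    fix n i x assume "i \<in> I" "x \<in> simplices (X i) n"
    then have "wedge_in X x0 i n x \<in> simplices (wedge I X x0) n" by (auto simp: wedge_simps)
    then show "p n (q n (wedge_in X x0 i n x)) = p' n (q' n (wedge_in X x0 i n x))"
      using w[of n "wedge_in X x0 i n x"] by simp
  qed
qed (fastforce simp: simplicial_comp_def compose_def wedge_simps fun_eq_iff)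

text \<open>The wedge represents the base simplex of every factor by \<open>None\<close>; the value there agrees with that of
  each factor map because the latter preserves the identity.\<close>

lemma wedge_map_nerve:
  assumes Y0: "\<And>n. base_simplex Y pt n = replicate n e"
    and one: "\<And>i. i \<in> I \<Longrightarrow> \<psi> i \<one>\<^bsub>H\<^esub> = e"
  defines "w \<equiv> wedge_map I (\<lambda>_. nerve H) (\<lambda>_. []) Y pt (\<lambda>i. induced_map (nerve H) (\<psi> i))"
  shows "w n None = replicate n e"
    and "i \<in> I \<Longrightarrow> x \<in> simplices (nerve H) n \<Longrightarrow> w n (wedge_in (\<lambda>_. nerve H) (\<lambda>_. []) i n x) = map (\<psi> i) x"
proof -
  show "w n None = replicate n e" by (simp add: w_def wedge_map_def wedge_simps Y0)
  assume "i \<in> I" "x \<in> simplices (nerve H) n"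
  moreover from this have "wedge_in (\<lambda>_. nerve H) (\<lambda>_. []) i n x \<in> simplices (wedge I (\<lambda>_. nerve H) (\<lambda>_. [])) n"
    by (auto simp: wedge_simps)
  ultimately show "w n (wedge_in (\<lambda>_. nerve H) (\<lambda>_. []) i n x) = map (\<psi> i) x"
    by (auto simp: w_def wedge_map_def wedge_in_def Y0 base_simplex_full_nerve induced_map_def one)
qed

context complex_and_group
begin

text \<open>Both sides restrict on each wedge factor to maps induced by homomorphisms out of \<open>\<int>\<^sub>d\<close>; the edge \<open>[1]\<close>
  tests them on the generator, and the value on the generator determines the rest.\<close>

lemma compatible_iff:
  assumes \<theta>: "\<theta> \<in> simplexwise_homs d c \<Sigma> G" and \<Sigma>: "\<Sigma> = system_complex r c A"
    and sys: "linear_system d r c A b" and J: "J \<in> carrier G" "J [^] d = \<one>"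
  shows "simplicial_comp (NZ_wedge d r) (induced_map X \<theta>) (alpha_map d r c A)
      = simplicial_comp (NZ_wedge d r) (iota_map d G J) (beta_map d r b)
    \<longleftrightarrow> (\<forall>i<r. \<theta> (A i) = J [^] b i)"
proof -
  have A: "A i \<in> carrier F" "supp c (A i) \<in> \<Sigma>" if "i < r" for i
    using sys that unfolding linear_system_def \<Sigma> system_complex_def by blast+
  note alpha = wedge_map_nerve[where I = "{..<r}" and H = "Zmod d" and Y = X and pt = "[]"
      and e = "\<one>\<^bsub>F\<^esub>" and \<psi> = "\<lambda>i. cyclic_hom F (A i)", folded alpha_map_def[of d r c A, folded \<Sigma>]]
  have alpha: "alpha_map d r c A n None = replicate n \<one>\<^bsub>F\<^esub>"
    "i < r \<Longrightarrow> x \<in> simplices (nerve (Zmod d)) n \<Longrightarrow>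
      alpha_map d r c A n (wedge_in (\<lambda>_. nerve (Zmod d)) (\<lambda>_. []) i n x) = map (cyclic_hom F (A i)) x" for n i x
    by (rule alpha; simp add: N_complex_def base_simplex_nerve cyclic_hom_def del: one_product_group)+
  note beta = wedge_map_nerve[where I = "{..<r}" and H = "Zmod d" and Y = "nerve (Zmod d)" and pt = "[]"
      and e = "0" and \<psi> = "\<lambda>i. cyclic_hom (Zmod d) (b i)", folded beta_map_def[of d r b]]
  have beta: "beta_map d r b n None = replicate n 0"
    "i < r \<Longrightarrow> x \<in> simplices (nerve (Zmod d)) n \<Longrightarrow>
      beta_map d r b n (wedge_in (\<lambda>_. nerve (Zmod d)) (\<lambda>_. []) i n x) = map (cyclic_hom (Zmod d) (b i)) x" for n i x
    by (rule beta; simp add: base_simplex_full_nerve cyclic_hom_def)+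
  have Z_iff: "k \<in> carrier (Zmod d) \<longleftrightarrow> 0 \<le> k \<and> k < int d" for k
    using d_gt_1 by (auto simp: carrier_integer_mod_group)
  have cb: "cyclic_hom (Zmod d) (b i) k = (k * b i) mod int d" for i k
    by (simp add: cyclic_hom_def int_pow_integer_mod_group)
  have iota: "iota_map d G J n x = map (cyclic_hom G J) x" if "x \<in> simplices (nerve (Zmod d)) n" for n x
    using that by (simp add: iota_map_def induced_map_def)
  have Jmod: "J [^] (k mod int d) = J [^] k" for k
  proof -
    have "J [^] k = (J [^] int d) [^] (k div int d) \<otimes> J [^] (k mod int d)"
      using J(1) by (simp add: int_pow_pow flip: int_pow_mult)
    then show ?thesis using J by (simp add: int_pow_int)
  qed
  have cA: "cyclic_hom F (A i) k \<in> carrier F" "supp c (cyclic_hom F (A i) k) \<subseteq> supp c (A i)"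
     "\<theta> (cyclic_hom F (A i) k) = \<theta> (A i) [^] k"
    if "i < r" "0 \<le> k" for i k
  proof -
    have k: "cyclic_hom F (A i) k = A i [^]\<^bsub>F\<^esub> nat k" "\<theta> (A i) [^] k = \<theta> (A i) [^] nat k"
      using that(2) unfolding cyclic_hom_def by (metis int_pow_int nat_0_le)+
    show "cyclic_hom F (A i) k \<in> carrier F" "supp c (cyclic_hom F (A i) k) \<subseteq> supp c (A i)"
     "\<theta> (cyclic_hom F (A i) k) = \<theta> (A i) [^] k"
      unfolding k
      by (rule F.nat_pow_closed[OF A(1)[OF that(1)]] supp_pow[OF A(1)[OF that(1)]]
          simplexwise_hom_pow[OF \<theta> A[OF that(1)]])+
  qed
  have inX: "map (cyclic_hom F (A i)) x \<in> simplices X n"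
    if "i < r" "x \<in> simplices (nerve (Zmod d)) n" for i x n
  proof -
    have x: "0 \<le> k" if "k \<in> set x" for k using that \<open>x \<in> _\<close> Z_iff by (auto simp: nerve_simps)
    have "(\<Union>s\<in>set (map (cyclic_hom F (A i)) x). supp c s) \<subseteq> supp c (A i)"
      using cA(2)[OF that(1) x] by auto
    from subset_closed[OF A(2)[OF that(1)] this] cA(1)[OF that(1) x] that(2) show ?thesis
      unfolding X_iff by (auto simp: nerve_simps simp del: carrier_product_group)
  qed
  have inZ: "map (cyclic_hom (Zmod d) (b i)) x \<in> simplices (nerve (Zmod d)) n"
    if "x \<in> simplices (nerve (Zmod d)) n" for i x n
    using that d_gt_1 by (auto simp: nerve_simps cb Z_iff)
  have ones: "replicate n \<one>\<^bsub>F\<^esub> \<in> simplices X n" for n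
    using empty_simplex F.one_closed
    by (auto simp: X_iff supp_one simp del: carrier_product_group one_product_group)
  have zeros: "replicate n 0 \<in> simplices (nerve (Zmod d)) n" for n by (auto simp: nerve_simps)
  have "simplicial_comp (NZ_wedge d r) (induced_map X \<theta>) (alpha_map d r c A)
      = simplicial_comp (NZ_wedge d r) (iota_map d G J) (beta_map d r b)
    \<longleftrightarrow> (\<forall>n. \<forall>i\<in>{..<r}. \<forall>x\<in>simplices (nerve (Zmod d)) n.
          map \<theta> (map (cyclic_hom F (A i)) x) = map (cyclic_hom G J) (map (cyclic_hom (Zmod d) (b i)) x))"
    unfolding NZ_wedge_def simplicial_comp_wedge_eq_iff
    using ones zeros inX inZ simplexwise_hom_one[OF \<theta>]
    by (simp add: alpha beta iota induced_map_def cyclic_hom_def del: one_product_group map_map)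
  also have "\<dots> \<longleftrightarrow> (\<forall>i<r. \<theta> (A i) = J [^] b i)" (is "?l \<longleftrightarrow> ?r")
  proof
    assume l: ?l
    show ?r
    proof (intro allI impI)
      fix i assume i: "i < r"
      have "[1] \<in> simplices (nerve (Zmod d)) 1" using d_gt_1 by (simp add: nerve_simps Z_iff)
      with l i have "\<theta> (cyclic_hom F (A i) 1) = cyclic_hom G J (cyclic_hom (Zmod d) (b i) 1)" by fastforce
      then have "\<theta> (A i) [^] (1::int) = J [^] ((1 * b i) mod int d)"
        using cA(3)[OF i, of 1] by (simp only: cb cyclic_hom_def[of G] zero_le_one)
      then show "\<theta> (A i) = J [^] b i"
        using simplexwise_hom_closed[OF \<theta> A[OF i]] by (simp add: Jmod)
    qed
  next
    assume r: ?r
    have "\<theta> (cyclic_hom F (A i) k) = cyclic_hom G J (cyclic_hom (Zmod d) (b i) k)"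
      if "i < r" "k \<in> carrier (Zmod d)" for i k
    proof -
      have "\<theta> (cyclic_hom F (A i) k) = (J [^] b i) [^] k"
        using cA(3)[OF that(1)] r that by (simp add: Z_iff)
      also have "\<dots> = J [^] ((k * b i) mod int d)"
        using J(1) by (simp add: Jmod int_pow_pow mult.commute)
      finally show ?thesis by (simp only: cb cyclic_hom_def[of G])
    qed
    then show ?l by (auto simp: nerve_simps subset_iff)
  qed
  finally show ?thesis .
qed

end

theorem proposition2p11:
  fixes d r c :: nat
    and A :: "nat \<Rightarrow> nat \<Rightarrow> int" and b :: "nat \<Rightarrow> int"
    and G :: "('g, 'm) monoid_scheme" and J :: 'g
  assumes "d > 1"
    and "linear_system d r c A b"
    and "\<And>i. i < r \<Longrightarrow> subgroup_generated (Zd_functions d c) {A i} \<cong> Zmod d"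
    and "\<And>i j. \<lbrakk>i < r; j < r; i \<noteq> j\<rbrakk> \<Longrightarrow> generate (Zd_functions d c) {A i} \<noteq> generate (Zd_functions d c) {A j}"
    and "group G"
    and "J \<in> carrier G"
    and "\<And>x. x \<in> carrier G \<Longrightarrow> J \<otimes>\<^bsub>G\<^esub> x = x \<otimes>\<^bsub>G\<^esub> J"
    and "group.ord G J = d"
  shows "\<exists>\<Phi>. bij_betw \<Phi> (Sol d r c A b G J)
     {f \<in> simplicial_maps (N_complex d c (system_complex r c A)) (N_torsion d G).
        simplicial_comp (NZ_wedge d r) f (alpha_map d r c A)
        = simplicial_comp (NZ_wedge d r) (iota_map d G J) (beta_map d r b)}"
proof -
  interpret group G by fact
  let ?\<Sigma> = "system_complex r c A"
  interpret complex_and_group G d c ?\<Sigma>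
  proof
    show "\<tau> \<in> ?\<Sigma>" if "\<sigma> \<in> ?\<Sigma>" "\<tau> \<subseteq> \<sigma>" for \<sigma> \<tau> using that by (rule system_complex_subset)
  qed (use assms(1) in \<open>auto simp: system_complex_def supp_def\<close>)
  let ?M = "\<lambda>f. simplicial_comp (NZ_wedge d r) f (alpha_map d r c A)
        = simplicial_comp (NZ_wedge d r) (iota_map d G J) (beta_map d r b)"
  let ?L = "linear_extension d c ?\<Sigma> G" and ?C = "commuting_assignments d c ?\<Sigma> G"
  have bij: "bij_betw (induced_map X \<circ> ?L) ?C (simplicial_maps X Y)"
    by (rule bij_betw_trans[OF bij_linear_extension bij_induced_map])
  have J: "J [^]\<^bsub>G\<^esub> d = \<one>\<^bsub>G\<^esub>" using assms(6,8) pow_ord_eq_1 by blast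
  have edge: "A i \<in> edge_functions d c ?\<Sigma>" if "i < r" for i
    using assms(2) that unfolding linear_system_def edge_functions_def system_complex_def by blast
  have M: "?M (induced_map X (?L T)) \<longleftrightarrow> (\<forall>i<r. ordered_prod G (\<lambda>j. T j [^]\<^bsub>G\<^esub> A i j)
      (sorted_list_of_set (supp c (A i))) = J [^]\<^bsub>G\<^esub> b i)" if "T \<in> ?C" for T
    using compatible_iff[OF linear_extension_hom[OF that] refl assms(2,6) J] edge
    by (simp add: linear_extension_def)
  (* A simplex with a single vertex imposes no commutation. *)
  have comm: "(\<forall>\<sigma>\<in>?\<Sigma>. \<forall>j\<in>\<sigma>. \<forall>k\<in>\<sigma>. T j \<otimes>\<^bsub>G\<^esub> T k = T k \<otimes>\<^bsub>G\<^esub> T j) \<longleftrightarrow>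
      (\<forall>i<r. \<forall>j \<in> supp c (A i). \<forall>k \<in> supp c (A i). T j \<otimes>\<^bsub>G\<^esub> T k = T k \<otimes>\<^bsub>G\<^esub> T j)" for T
    by (auto simp: system_complex_def)
  have Sol: "Sol d r c A b G J = {T \<in> ?C. ?M (induced_map X (?L T))}"
    unfolding Sol_def commuting_assignments_def comm using M[unfolded commuting_assignments_def comm]
    by auto
  have "bij_betw (induced_map X \<circ> ?L) (Sol d r c A b G J) {f \<in> simplicial_maps X Y. ?M f}"
    using bij unfolding Sol bij_betw_def inj_on_def by (auto simp: image_iff)
  then show ?thesis by blast
qed

end
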